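(* Let $\mathbb{F}$ be a field of characteristic zero. Let $k,d>0$ be arbitrary integers and let $P\in\mathbb{F}[z_1,\ldots,z_k]$ be a $k$-variate polynomial of degree $d$. Let $n,D,s$ be positive integers, and suppose that $P$ cannot be computed by algebraic circuits of size $\tilde{s}=s\cdot D\cdot d^3\cdot n^{10k}$. Then for every $(n+1)$-variate polynomial $C(x_0,\ldots,x_n)\in\mathcal{C}(n+1,D,s)$ we have \[ C\neq 0 \iff C\circ \mathsf{Gen}_P(\mathbf{z},\mathbf{y})\neq 0 . \]
   Context: An algebraic circuit over $\mathbb{F}$ is a directed acyclic graph whose internal nodes are labelled by $+$ and $\times$, whose leaves are labelled by variables or field constants, and whose edges may carry arbitrary field constants that scale the value passing through them; gates compute the sum/product of their children. The size of a circuit is its number of gates (independent of the constants used). $\mathcal{C}(m,D,s)$ denotes the class of $m$-variate polynomials of total degree at most $D$ computable by algebraic circuits of size at most $s$. For $\mathbf{e}\in\mathbb{Z}_{\ge 0}^k$ write $|\mathbf{e}|=e_1+\cdots+e_k$, $\mathbf{e}!=e_1!\cdots e_k!$, $\mathbf{y}^{\mathbf{e}}=y_1^{e_1}\cdots y_k^{e_k}$ and $\partial_{\mathbf{z}^{\mathbf{e}}}P=\frac{\partial^{|\mathbf{e}|}P}{\partial z_1^{e_1}\cdots\partial z_k^{e_k}}$. For $i\ge 0$ define $\Delta_i(P)(\mathbf{z},\mathbf{y})=\sum_{|\mathbf{e}|=i}\frac{\mathbf{y}^{\mathbf{e}}}{\mathbf{e}!}\,\partial_{\mathbf{z}^{\mathbf{e}}}P(\mathbf{z})\in\mathbb{F}[z_1,\ldots,z_k,y_1,\ldots,y_k]$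 (the part of the Taylor expansion of $P(\mathbf{z}+\mathbf{y})$ that is homogeneous of degree $i$ in $\mathbf{y}$). The generator is the polynomial map $\mathsf{Gen}_P:\mathbb{F}^k\times\mathbb{F}^k\to\mathbb{F}^{n+1}$, $\mathsf{Gen}_P(\mathbf{z},\mathbf{y})=(\Delta_0(P)(\mathbf{z},\mathbf{y}),\Delta_1(P)(\mathbf{z},\mathbf{y}),\ldots,\Delta_n(P)(\mathbf{z},\mathbf{y}))$, and $C\circ\mathsf{Gen}_P$ denotes the polynomial $C(\Delta_0(P),\ldots,\Delta_n(P))\in\mathbb{F}[\mathbf{z},\mathbf{y}]$. *)

theory Defs
  imports Complex_Main "HOL-Library.Poly_Mapping"
begin

section \<open>Multivariate polynomials\<close>

text \<open>
  Polynomials in the variables with indices \<open>0, 1, 2, \<dots>\<close> are finitely supported maps from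
  monomials (finitely supported exponent vectors) to coefficients; the ring structure is the
  convolution ring of \<^theory>\<open>HOL-Library.Poly_Mapping\<close>.
\<close>

type_synonym monom = "nat \<Rightarrow>\<^sub>0 nat"
type_synonym 'a mpoly = "monom \<Rightarrow>\<^sub>0 'a"

definition Const :: "'a::zero \<Rightarrow> 'a mpoly" where
  "Const c = Poly_Mapping.single 0 c"

definition Var :: "nat \<Rightarrow> 'a::zero_neq_one mpoly" where
  "Var i = Poly_Mapping.single (Poly_Mapping.single i 1) 1"

definition mpolys :: "nat \<Rightarrow> 'a::zero mpoly set" where
  "mpolys m = {p. \<forall>e \<in> Poly_Mapping.keys p. Poly_Mapping.keys e \<subseteq> {..<m}}"

definition monom_degree :: "monom \<Rightarrow> nat" where
  "monom_degree e = (\<Sum>i \<in> Poly_Mapping.keys e. Poly_Mapping.lookup e i)"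

text \<open>By convention the zero polynomial has degree \<open>0\<close>.\<close>

definition total_degree :: "'a::zero mpoly \<Rightarrow> nat" where
  "total_degree p = Max (insert 0 (monom_degree ` Poly_Mapping.keys p))"

definition mpoly_subst :: "(nat \<Rightarrow> 'a mpoly) \<Rightarrow> 'a mpoly \<Rightarrow> 'a::comm_semiring_1 mpoly" where
  "mpoly_subst f p =
     (\<Sum>e \<in> Poly_Mapping.keys p.
        Const (Poly_Mapping.lookup p e) *
        (\<Prod>i \<in> Poly_Mapping.keys e. f i ^ Poly_Mapping.lookup e i))"

text \<open>
  In the following definition the subtraction of exponents truncates only for monomials that do
  not contain the variable \<open>i\<close>, and these have coefficient \<open>0\<close>.
\<close>

definition pderiv_mpoly :: "nat \<Rightarrow> 'a mpoly \<Rightarrow> 'a::comm_semiring_1 mpoly" where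
  "pderiv_mpoly i p =
     (\<Sum>e \<in> Poly_Mapping.keys p.
        Poly_Mapping.single (e - Poly_Mapping.single i 1)
          (of_nat (Poly_Mapping.lookup e i) * Poly_Mapping.lookup p e))"

section \<open>Algebraic circuits\<close>

text \<open>
  The nodes of a circuit are natural numbers. An internal node stores the list of its incoming
  edges, each consisting of the scalar carried by the edge and the child it comes from. Fan-in is
  unbounded and parallel edges are allowed, so that one multiplication gate can square a value.
\<close>

datatype 'a gate =
    Var_Leaf nat
  | Const_Leaf 'a
  | Plus "('a \<times> nat) list"
  | Times "('a \<times> nat) list"

primrec in_edges :: "'a gate \<Rightarrow> ('a \<times> nat) list" where
  "in_edges (Var_Leaf i) = []"
| "in_edges (Const_Leaf c) = []"
| "in_edges (Plus es) = es"
| "in_edges (Times es) = es"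

record 'a circuit =
  nodes :: "nat set"
  label :: "nat \<Rightarrow> 'a gate"
  out :: nat

definition circuit_edges :: "'a circuit \<Rightarrow> (nat \<times> nat) set" where
  "circuit_edges G = {(u, v). v \<in> nodes G \<and> u \<in> snd ` set (in_edges (label G v))}"

text \<open>The first argument is the number of variables.\<close>

primrec gate_ok :: "nat \<Rightarrow> 'a gate \<Rightarrow> bool" where
  "gate_ok m (Var_Leaf i) \<longleftrightarrow> i < m"
| "gate_ok m (Const_Leaf c) \<longleftrightarrow> True"
| "gate_ok m (Plus es) \<longleftrightarrow> es \<noteq> []"
| "gate_ok m (Times es) \<longleftrightarrow> es \<noteq> []"

definition is_circuit :: "nat \<Rightarrow> 'a circuit \<Rightarrow> bool" where
  "is_circuit m G \<longleftrightarrow>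
     finite (nodes G) \<and> out G \<in> nodes G \<and>
     (\<forall>v \<in> nodes G. gate_ok m (label G v)) \<and>
     circuit_edges G \<subseteq> nodes G \<times> nodes G \<and> acyclic (circuit_edges G)"

text \<open>All nodes are gates: the leaves are the input gates, and they count towards the size.\<close>

definition circuit_size :: "'a circuit \<Rightarrow> nat" where
  "circuit_size G = card (nodes G)"

primrec gate_value :: "(nat \<Rightarrow> 'a mpoly) \<Rightarrow> 'a gate \<Rightarrow> 'a::comm_semiring_1 mpoly" where
  "gate_value val (Var_Leaf i) = Var i"
| "gate_value val (Const_Leaf c) = Const c"
| "gate_value val (Plus es) = sum_list (map (\<lambda>(c, u). Const c * val u) es)"
| "gate_value val (Times es) = prod_list (map (\<lambda>(c, u). Const c * val u) es)"

text \<open>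
  A valuation assigns to every node the polynomial computed there; on the nodes of a circuit it
  exists and is unique, as the two lemmas below show.
\<close>

definition circuit_valuation :: "'a circuit \<Rightarrow> (nat \<Rightarrow> 'a::comm_semiring_1 mpoly) \<Rightarrow> bool" where
  "circuit_valuation G val \<longleftrightarrow> (\<forall>v \<in> nodes G. val v = gate_value val (label G v))"

definition computes :: "'a circuit \<Rightarrow> 'a::comm_semiring_1 mpoly \<Rightarrow> bool" where
  "computes G p \<longleftrightarrow> (\<exists>val. circuit_valuation G val \<and> val (out G) = p)"

lemma gate_value_cong:
  assumes "\<And>u. u \<in> snd ` set (in_edges g) \<Longrightarrow> val u = val' u"
  shows "gate_value val g = gate_value val' g"
proof -
  have "map (\<lambda>(c, u). Const c * val u) (in_edges g) = map (\<lambda>(c, u). Const c * val' u) (in_edges g)"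
  proof (rule map_cong[OF refl])
    fix x assume "x \<in> set (in_edges g)"
    then have "val (snd x) = val' (snd x)" by (intro assms imageI)
    then show "(case x of (c, u) \<Rightarrow> Const c * val u) = (case x of (c, u) \<Rightarrow> Const c * val' u)"
      by (simp add: case_prod_unfold)
  qed
  then show ?thesis by (cases g) (simp_all del: map_eq_conv)
qed

lemma wf_circuit_edges:
  assumes "is_circuit m G"
  shows "wf (circuit_edges G)"
proof -
  have "finite (nodes G \<times> nodes G)" using assms by (simp add: is_circuit_def)
  moreover have "circuit_edges G \<subseteq> nodes G \<times> nodes G"
    using assms unfolding is_circuit_def by blast
  ultimately have "finite (circuit_edges G)" by (rule rev_finite_subset)
  then show ?thesis using assms by (simp add: is_circuit_def finite_acyclic_wf)
qed

lemma circuit_valuation_exists: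
  assumes "is_circuit m (G :: 'a::comm_semiring_1 circuit)"
  shows "\<exists>val. circuit_valuation G val"
proof -
  define F where "F = (\<lambda>val v. gate_value val (label G v))"
  define val where "val = wfrec (circuit_edges G) F"
  have "val v = gate_value val (label G v)" if "v \<in> nodes G" for v
  proof -
    have "val v = F (cut val (circuit_edges G) v) v"
      unfolding val_def by (rule wfrec[OF wf_circuit_edges[OF assms]])
    also have "\<dots> = gate_value val (label G v)"
      unfolding F_def
    proof (rule gate_value_cong)
      fix u assume "u \<in> snd ` set (in_edges (label G v))"
      then have "(u, v) \<in> circuit_edges G" using that by (simp add: circuit_edges_def)
      then show "cut val (circuit_edges G) v u = val u" by (rule cut_apply)
    qed
    finally show ?thesis .
  qed
  then show ?thesis unfolding circuit_valuation_def by blast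
qed

lemma circuit_valuation_unique:
  assumes G: "is_circuit m G" and val: "circuit_valuation G val" "circuit_valuation G val'"
    and v: "v \<in> nodes G"
  shows "val v = val' v"
  using wf_circuit_edges[OF G] v
proof (induction v rule: wf_induct_rule)
  case (less v)
  have "val u = val' u" if "u \<in> snd ` set (in_edges (label G v))" for u
  proof -
    have "(u, v) \<in> circuit_edges G" using that less.prems by (simp add: circuit_edges_def)
    moreover from this have "u \<in> nodes G" using G unfolding is_circuit_def by blast
    ultimately show ?thesis using less.IH by blast
  qed
  then have "gate_value val (label G v) = gate_value val' (label G v)"
    by (rule gate_value_cong)
  then show ?case using val less.prems by (simp add: circuit_valuation_def)
qed

definition computable_in_size :: "nat \<Rightarrow> nat \<Rightarrow> 'a::comm_semiring_1 mpoly \<Rightarrow> bool" where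
  "computable_in_size m s p \<longleftrightarrow> (\<exists>G. is_circuit m G \<and> circuit_size G \<le> s \<and> computes G p)"

definition circuit_class :: "nat \<Rightarrow> nat \<Rightarrow> nat \<Rightarrow> 'a::comm_semiring_1 mpoly set" where
  "circuit_class m D s = {p \<in> mpolys m. total_degree p \<le> D \<and> computable_in_size m s p}"

section \<open>The generator\<close>

text \<open>
  The variables \<open>z\<^sub>1, \<dots>, z\<^sub>k\<close> have the indices \<open>0, \<dots>, k - 1\<close> and the variables
  \<open>y\<^sub>1, \<dots>, y\<^sub>k\<close> the indices \<open>k, \<dots>, 2 * k - 1\<close>.
\<close>

definition exponents :: "nat \<Rightarrow> nat \<Rightarrow> monom set" where
  "exponents k i = {e. Poly_Mapping.keys e \<subseteq> {..<k} \<and> (\<Sum>j<k. Poly_Mapping.lookup e j) = i}"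

text \<open>The sum over \<open>exponents k i\<close> in the definition of \<open>Delta\<close> is a sum over a finite set.\<close>

lemma finite_exponents: "finite (exponents k i)"
proof (rule finite_imageD)
  show "inj_on Poly_Mapping.lookup (exponents k i)"
    by (rule inj_onI) (rule poly_mapping_eqI, simp)
  let ?S = "{f. \<forall>x. (x \<in> {..<k} \<longrightarrow> f x \<in> {..i}) \<and> (x \<notin> {..<k} \<longrightarrow> f x = (0::nat))}"
  have "Poly_Mapping.lookup ` exponents k i \<subseteq> ?S"
  proof (rule image_subsetI)
    fix e assume e: "e \<in> exponents k i"
    have sum: "(\<Sum>j<k. Poly_Mapping.lookup e j) = i"
      and keys: "Poly_Mapping.keys e \<subseteq> {..<k}"
      using e unfolding exponents_def by blast+
    have "Poly_Mapping.lookup e x \<le> i" if "x \<in> {..<k}" for x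
      unfolding sum[symmetric] using that by (intro member_le_sum) simp_all
    moreover have "Poly_Mapping.lookup e x = 0" if "x \<notin> {..<k}" for x
      using keys that in_keys_iff[of x e] by blast
    ultimately show "Poly_Mapping.lookup e \<in> ?S" by blast
  qed
  then show "finite (Poly_Mapping.lookup ` exponents k i)"
    by (rule finite_subset) (intro finite_set_of_finite_funs finite_lessThan finite_atMost)
qed

definition iterated_pderiv :: "nat \<Rightarrow> monom \<Rightarrow> 'a mpoly \<Rightarrow> 'a::comm_semiring_1 mpoly" where
  "iterated_pderiv k e = fold (\<lambda>j. pderiv_mpoly j ^^ Poly_Mapping.lookup e j) [0..<k]"

definition Delta :: "nat \<Rightarrow> 'a mpoly \<Rightarrow> nat \<Rightarrow> 'a::field_char_0 mpoly" where
  "Delta k P i =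
     (\<Sum>e \<in> exponents k i.
        Const (1 / (\<Prod>j<k. fact (Poly_Mapping.lookup e j))) *
        (\<Prod>j<k. Var (k + j) ^ Poly_Mapping.lookup e j) *
        iterated_pderiv k e P)"

definition Gen :: "nat \<Rightarrow> nat \<Rightarrow> 'a mpoly \<Rightarrow> 'a::field_char_0 mpoly list" where
  "Gen k n P = map (Delta k P) [0..<Suc n]"

definition compose_Gen :: "'a mpoly \<Rightarrow> 'a mpoly list \<Rightarrow> 'a::field_char_0 mpoly" where
  "compose_Gen C gs = mpoly_subst (\<lambda>i. gs ! i) C"

end

theory Submission
  imports Defs "HOL-Computational_Algebra.Polynomial_FPS"
begin

text \<open>
  Suppose that \<open>C \<noteq> 0\<close> but \<open>C \<circ> Gen = 0\<close>. Freezing the variables of \<open>C\<close> one after the other at a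
  point where \<open>C\<close> does not vanish gives an index \<open>\<nu>\<close> such that \<open>\<Delta>\<^sub>\<nu>\<close> is a root, of some multiplicity
  \<open>r \<ge> 1\<close>, of the nonzero univariate polynomial
  \<open>C(\<Delta>\<^sub>0, \<dots>, \<Delta>\<^sub>\<nu>\<^sub>-\<^sub>1, x, \<beta>\<^sub>\<nu>\<^sub>+\<^sub>1, \<dots>)\<close>. For \<open>\<nu> \<le> 1\<close> this is impossible. For \<open>\<nu> \<ge> 2\<close> expand everything
  around a generic point \<open>a\<close> along \<open>z = a + (z - a)t\<close>. If the homogeneous parts of \<open>P\<close> of degree
  less than \<open>\<nu> + R\<close> are known, then the only unknown among the coefficients of order \<open>\<le> R\<close> of the
  \<open>\<Delta>\<^sub>i\<close>, \<open>i \<le> \<nu>\<close>, is the one of \<open>\<Delta>\<^sub>\<nu>\<close> of order \<open>R\<close>. It enters the order \<open>R\<close> part of the derivative of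
  order \<open>r - 1\<close> of that polynomial linearly with a nonzero constant coefficient, so it can be solved
  for. Interpolation in \<open>y\<close> and Euler's identity then give the part of \<open>P\<close> of degree \<open>\<nu> + R\<close>.

  The derivative costs a factor \<open>D + 1\<close> (interpolation in \<open>x\<close>). Extracting the coefficients in \<open>t\<close>
  by interpolation as well would cost another factor \<open>D\<close>; instead each gate is expanded as a power
  series in \<open>t\<close>. Multiplication gates of unbounded fan-in are handled by carrying along the logarithmic
  derivative, which turns the product into a sum.
\<close>

unbundle fps_syntax

abbreviation "lookup \<equiv> Poly_Mapping.lookup"
abbreviation "keys \<equiv> Poly_Mapping.keys"
abbreviation "single \<equiv> Poly_Mapping.single"

section \<open>Evaluation homomorphisms\<close>

text \<open>A predicate on plain functions: constant embeddings, evaluations at points and constant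
  terms of series get composed and passed as the coefficient map of \<open>ev\<close>.\<close>

definition is_hom :: "('a::comm_semiring_1 \<Rightarrow> 'b::comm_semiring_1) \<Rightarrow> bool" where
  "is_hom \<phi> \<longleftrightarrow> \<phi> 0 = 0 \<and> \<phi> 1 = 1 \<and>
     (\<forall>x y. \<phi> (x + y) = \<phi> x + \<phi> y) \<and> (\<forall>x y. \<phi> (x * y) = \<phi> x * \<phi> y)"

lemma hom_zero: "is_hom \<phi> \<Longrightarrow> \<phi> 0 = 0"
  and hom_one: "is_hom \<phi> \<Longrightarrow> \<phi> 1 = 1"
  and hom_add: "is_hom \<phi> \<Longrightarrow> \<phi> (x + y) = \<phi> x + \<phi> y"
  and hom_mult: "is_hom \<phi> \<Longrightarrow> \<phi> (x * y) = \<phi> x * \<phi> y"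
  by (auto simp: is_hom_def)

lemma hom_diff:
  fixes \<phi> :: "'a::comm_ring_1 \<Rightarrow> 'b::comm_ring_1"
  assumes "is_hom \<phi>"
  shows "\<phi> (x - y) = \<phi> x - \<phi> y"
  using hom_add[OF assms, of "x - y" y] by (simp add: algebra_simps)

lemma hom_sum: "is_hom \<phi> \<Longrightarrow> \<phi> (sum f A) = (\<Sum>i\<in>A. \<phi> (f i))"
  by (induction A rule: infinite_finite_induct) (auto simp: hom_zero hom_add)

lemma hom_prod: "is_hom \<phi> \<Longrightarrow> \<phi> (prod f A) = (\<Prod>i\<in>A. \<phi> (f i))"
  by (induction A rule: infinite_finite_induct) (auto simp: hom_one hom_mult)

lemma hom_power: "is_hom \<phi> \<Longrightarrow> \<phi> (x ^ n) = \<phi> x ^ n"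
  by (induction n) (auto simp: hom_one hom_mult)

lemma hom_of_nat: "is_hom \<phi> \<Longrightarrow> \<phi> (of_nat n) = of_nat n"
  by (induction n) (auto simp: hom_one hom_zero hom_add)

lemma hom_sum_list: "is_hom \<phi> \<Longrightarrow> \<phi> (sum_list (map f xs)) = sum_list (map (\<lambda>x. \<phi> (f x)) xs)"
  by (induction xs) (auto simp: hom_zero hom_add)

lemma hom_prod_list: "is_hom \<phi> \<Longrightarrow> \<phi> (prod_list (map f xs)) = prod_list (map (\<lambda>x. \<phi> (f x)) xs)"
  by (induction xs) (auto simp: hom_one hom_mult)

lemma is_hom_comp: "is_hom \<phi> \<Longrightarrow> is_hom \<psi> \<Longrightarrow> is_hom (\<lambda>x. \<phi> (\<psi> x))"
  by (simp add: is_hom_def)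

text \<open>One evaluation map for all targets: \<open>Const\<close> for substitution, the identity
  for values at points, \<open>[:Const c:]\<close> for polynomials in one distinguished variable,
  \<open>cst\<close> for power series in t.\<close>

definition ev :: "('a::comm_semiring_1 \<Rightarrow> 'b) \<Rightarrow> (nat \<Rightarrow> 'b) \<Rightarrow> 'a mpoly \<Rightarrow> 'b::comm_semiring_1" where
  "ev h f p = (\<Sum>e\<in>keys p. h (lookup p e) * (\<Prod>i\<in>keys e. f i ^ lookup e i))"

lemma mpoly_subst_ev: "mpoly_subst = ev Const"
  by (simp add: fun_eq_iff mpoly_subst_def ev_def)

lemma is_hom_Const [simp]: "is_hom Const"
  by (auto simp: is_hom_def Const_def single_add mult_single)

lemma is_hom_id [simp]: "is_hom (\<lambda>x. x)"
  by (simp add: is_hom_def)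

lemma is_hom_fps_const [simp]: "is_hom fps_const"
  by (simp add: is_hom_def)

lemma is_hom_pCons [simp]: "is_hom (\<lambda>c. [:c:])"
  by (simp add: is_hom_def one_pCons mult.commute)

lemma is_hom_poly: "is_hom (\<lambda>q. poly q x)"
  by (simp add: is_hom_def)

lemma is_hom_fps_of_poly: "is_hom fps_of_poly"
  by (simp add: is_hom_def fps_of_poly_add fps_of_poly_mult)

lemma prod_keys_superset:
  fixes f :: "nat \<Rightarrow> 'b::comm_monoid_mult"
  assumes "finite I" "keys e \<subseteq> I"
  shows "(\<Prod>i\<in>keys e. f i ^ lookup e i) = (\<Prod>i\<in>I. f i ^ lookup e i)"
  using assms by (intro prod.mono_neutral_left) (auto simp: in_keys_iff)

lemma prod_keys_add:
  fixes f :: "nat \<Rightarrow> 'b::comm_monoid_mult"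
  shows "(\<Prod>i\<in>keys (e + e'). f i ^ lookup (e + e') i) =
    (\<Prod>i\<in>keys e. f i ^ lookup e i) * (\<Prod>i\<in>keys e'. f i ^ lookup e' i)"
proof -
  let ?I = "keys e \<union> keys e'"
  have "(\<Prod>i\<in>keys (e + e'). f i ^ lookup (e + e') i) = (\<Prod>i\<in>?I. f i ^ lookup (e + e') i)"
    by (rule prod_keys_superset) (use keys_add[of e e'] in auto)
  also have "\<dots> = (\<Prod>i\<in>?I. f i ^ lookup e i) * (\<Prod>i\<in>?I. f i ^ lookup e' i)"
    by (simp add: lookup_add power_add prod.distrib)
  finally show ?thesis
    using prod_keys_superset[of ?I e f] prod_keys_superset[of ?I e' f] by simp
qed

lemma ev_superset:
  assumes "is_hom h" "finite E" "keys p \<subseteq> E"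
  shows "ev h f p = (\<Sum>e\<in>E. h (lookup p e) * (\<Prod>i\<in>keys e. f i ^ lookup e i))"
  unfolding ev_def using assms
  by (intro sum.mono_neutral_left) (auto simp: in_keys_iff hom_zero)

lemma ev_add:
  assumes "is_hom h"
  shows "ev h f (p + q) = ev h f p + ev h f q"
proof -
  let ?E = "keys p \<union> keys q"
  have "keys (p + q) \<subseteq> ?E" by (rule Poly_Mapping.keys_add)
  then show ?thesis
    using assms by (simp add: ev_superset[of h ?E] lookup_add hom_add distrib_right sum.distrib)
qed

lemma ev_zero [simp]: "ev h f 0 = 0"
  by (simp add: ev_def)

lemma ev_sum: "is_hom h \<Longrightarrow> ev h f (sum g A) = (\<Sum>i\<in>A. ev h f (g i))"
  by (induction A rule: infinite_finite_induct) (auto simp: ev_add)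

lemma ev_single: "is_hom h \<Longrightarrow> ev h f (single e c) = h c * (\<Prod>i\<in>keys e. f i ^ lookup e i)"
  by (cases "c = 0") (auto simp: ev_def hom_zero)

lemma mpoly_eq_sum_single: "p = (\<Sum>e\<in>keys p. single e (lookup p e))"
  by (rule poly_mapping_eqI) (simp add: lookup_sum lookup_single when_def in_keys_iff)

lemma ev_mult:
  assumes h: "is_hom h"
  shows "ev h f (p * q) = ev h f p * ev h f q"
proof -
  have "p * q = (\<Sum>e\<in>keys p. \<Sum>e'\<in>keys q. single (e + e') (lookup p e * lookup q e'))"
    by (subst mpoly_eq_sum_single[of p], subst mpoly_eq_sum_single[of q])
      (simp add: sum_product mult_single)
  then have "ev h f (p * q) =
      (\<Sum>e\<in>keys p. \<Sum>e'\<in>keys q. ev h f (single (e + e') (lookup p e * lookup q e')))"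
    by (simp add: ev_sum[OF h])
  also have "\<dots> = ev h f p * ev h f q"
    unfolding ev_single[OF h] prod_keys_add hom_mult[OF h] unfolding ev_def sum_product
    by (simp add: mult_ac)
  finally show ?thesis .
qed

lemma ev_Const [simp]: "is_hom h \<Longrightarrow> ev h f (Const c) = h c"
  by (simp add: Const_def ev_single)

lemma ev_Var [simp]: "is_hom h \<Longrightarrow> ev h f (Var i) = f i"
  by (simp add: Var_def ev_single hom_one)

lemma Const_0 [simp]: "Const 0 = 0"
  by (simp add: Const_def)

lemma Const_1 [simp]: "Const 1 = 1"
  by (simp add: Const_def)

lemma is_hom_ev: "is_hom h \<Longrightarrow> is_hom (ev h f)"
  using ev_Const[of h f 1] by (auto simp: is_hom_def ev_add ev_mult)

text \<open>The device for changing the target ring; nearly every later passage between two kinds of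
  evaluation is an instance.\<close>

lemma hom_ev: "is_hom \<phi> \<Longrightarrow> \<phi> (ev h f p) = ev (\<lambda>c. \<phi> (h c)) (\<lambda>i. \<phi> (f i)) p"
  by (simp add: ev_def hom_sum hom_mult hom_prod hom_power)

lemma ev_ev: "is_hom h \<Longrightarrow> ev h f (ev Const g p) = ev h (\<lambda>i. ev h f (g i)) p"
  by (simp add: hom_ev[OF is_hom_ev])

section \<open>Polynomials in boundedly many variables; induction on generators\<close>

lemma ev_cong: "p \<in> mpolys m \<Longrightarrow> (\<And>i. i < m \<Longrightarrow> f i = f' i) \<Longrightarrow> ev h f p = ev h f' p"
  unfolding ev_def mpolys_def by (intro sum.cong refl arg_cong2[where f="(*)"] prod.cong) (auto 4 3)

lemma mpolys_Const [simp]: "Const c \<in> mpolys m"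
  by (auto simp: mpolys_def Const_def)

lemma mpolys_zero [simp]: "0 \<in> mpolys m"
  by (auto simp: mpolys_def)

lemma mpolys_one [simp]: "1 \<in> mpolys m"
  by (auto simp: mpolys_def)

lemma mpolys_Var [simp]: "i < m \<Longrightarrow> Var i \<in> mpolys m"
  by (auto simp: mpolys_def Var_def)

lemma mpolys_add: "p \<in> mpolys m \<Longrightarrow> q \<in> mpolys m \<Longrightarrow> p + q \<in> mpolys m"
  using Poly_Mapping.keys_add[of p q] by (auto simp: mpolys_def)

lemma mpolys_mult:
  assumes "p \<in> mpolys m" "q \<in> mpolys m"
  shows "p * q \<in> mpolys m"
proof -
  have "keys e \<subseteq> {..<m}" if "e \<in> keys (p * q)" for e
  proof -
    obtain e1 e2 where "e = e1 + e2" "e1 \<in> keys p" "e2 \<in> keys q"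
      using keys_mult[of p q] \<open>e \<in> keys (p * q)\<close> by auto
    then show ?thesis
      using assms Poly_Mapping.keys_add[of e1 e2] unfolding mpolys_def by blast
  qed
  then show ?thesis by (simp add: mpolys_def)
qed

lemma mpolys_sum: "(\<And>i. i \<in> A \<Longrightarrow> f i \<in> mpolys m) \<Longrightarrow> sum f A \<in> mpolys m"
  by (induction A rule: infinite_finite_induct) (auto simp: mpolys_add)

lemma ex_mpolys: "\<exists>m. p \<in> mpolys m"
proof -
  have "finite (\<Union>e\<in>keys p. keys e)" by simp
  then obtain m where "\<forall>i\<in>(\<Union>e\<in>keys p. keys e). i < m"
    using finite_nat_set_iff_bounded by blast
  then have "p \<in> mpolys m" by (auto simp: mpolys_def)
  then show ?thesis ..
qed

lemma monom_nonzero_keys: "e \<noteq> 0 \<Longrightarrow> \<exists>i. i \<in> keys (e :: monom)"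
  by (metis in_keys_iff lookup_zero poly_mapping_eqI)

lemma single_minus_plus:
  fixes e :: monom
  assumes "i \<in> keys e"
  shows "single i 1 + (e - single i 1) = e"
  using assms by (intro poly_mapping_eqI) (auto simp: lookup_add lookup_minus lookup_single when_def in_keys_iff)

text \<open>Makes it possible to check identities between homomorphisms or derivations on
  generators. Monomials are built by splitting off one variable at a time and are then
  summed.\<close>

lemma mpolys_induct [consumes 1, case_names Const Var add mult]:
  fixes p :: "'a::comm_semiring_1 mpoly"
  assumes p: "p \<in> mpolys m"
    and Const: "\<And>c. P (Const c)"
    and Var: "\<And>i. i < m \<Longrightarrow> P (Var i)"
    and add: "\<And>p q. P p \<Longrightarrow> P q \<Longrightarrow> P (p + q)"
    and mult: "\<And>p q. P p \<Longrightarrow> P q \<Longrightarrow> P (p * q)"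
  shows "P p"
proof -
  have mono: "P (single e c)" if "keys e \<subseteq> {..<m}" for e and c :: 'a
    using that
  proof (induction "\<Sum>i<m. lookup e i" arbitrary: e rule: less_induct)
    case less
    show ?case
    proof (cases "e = 0")
      case True
      then show ?thesis using Const[of c] by (simp add: Const_def)
    next
      case False
      then obtain i where i: "i \<in> keys e" using monom_nonzero_keys by blast
      then have "i < m" using less.prems by auto
      let ?e = "e - single i 1"
      have e: "single i 1 + ?e = e" using i by (rule single_minus_plus)
      have "keys ?e \<subseteq> keys e" by (auto simp: in_keys_iff lookup_minus)
      then have sub: "keys ?e \<subseteq> {..<m}" using less.prems by blast
      have "(\<Sum>i<m. lookup ?e i) < (\<Sum>i<m. lookup e i)"
        using i \<open>i < m\<close>
        by (intro sum_strict_mono_ex1) (auto simp: lookup_minus lookup_single in_keys_iff intro!: bexI[of _ i])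
      then have "P (single ?e c)" using sub by (rule less.hyps)
      then have "P (Var i * single ?e c)" using Var[OF \<open>i < m\<close>] mult by blast
      then show ?thesis unfolding Var_def mult_single e by simp
    qed
  qed
  have "P (\<Sum>e\<in>E. single e (lookup p e))" if "finite E" "E \<subseteq> keys p" for E
    using that
  proof (induction E rule: finite_induct)
    case empty
    then show ?case using Const[of 0] by simp
  next
    case (insert e E)
    then show ?case using p by (auto simp: mpolys_def intro!: add mono)
  qed
  from this[of "keys p"] show ?thesis using mpoly_eq_sum_single[of p] by simp
qed

lemma mpoly_induct [case_names Const Var add mult]:
  fixes p :: "'a::comm_semiring_1 mpoly"
  assumes "\<And>c. P (Const c)" "\<And>i. P (Var i)" "\<And>p q. P p \<Longrightarrow> P q \<Longrightarrow> P (p + q)"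
    "\<And>p q. P p \<Longrightarrow> P q \<Longrightarrow> P (p * q)"
  shows "P p"
proof -
  obtain m where "p \<in> mpolys m" using ex_mpolys by blast
  then show ?thesis by (induction rule: mpolys_induct) (use assms in auto)
qed

lemma ev_Const_Var [simp]: "ev Const Var p = p"
  by (induction p rule: mpoly_induct) (auto simp: is_hom_Const ev_add ev_mult)

text \<open>Each variable becomes something at most linear, so a monomial contributes at most its
  own degree. Used for the degree in the line parameter t and in the displacement of one argument of
  \<open>C\<close>.\<close>

lemma degree_ev_le:
  fixes h :: "'a::comm_semiring_1 \<Rightarrow> 'b::comm_semiring_1 poly"
  assumes h: "\<And>c. degree (h c) = 0" and f: "\<And>i. degree (f i) \<le> 1"
  shows "degree (ev h f p) \<le> total_degree p"
  unfolding ev_def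
proof (rule degree_sum_le)
  fix e assume e: "e \<in> keys p"
  have "degree (h (lookup p e) * (\<Prod>i\<in>keys e. f i ^ lookup e i)) \<le>
      degree (h (lookup p e)) + degree (\<Prod>i\<in>keys e. f i ^ lookup e i)"
    by (rule degree_mult_le)
  also have "\<dots> \<le> (\<Sum>i\<in>keys e. degree (f i ^ lookup e i))"
    using h degree_prod_sum_le[OF finite_keys, of "\<lambda>i. f i ^ lookup e i"] by (simp add: o_def)
  also have "\<dots> \<le> (\<Sum>i\<in>keys e. lookup e i)"
  proof (rule sum_mono)
    fix i
    show "degree (f i ^ lookup e i) \<le> lookup e i"
      using order_trans[OF degree_power_le mult_right_mono[OF f[of i]]] by simp
  qed
  also have "\<dots> \<le> total_degree p"
    unfolding monom_degree_def[symmetric] total_degree_def using e by (intro Max_ge) auto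
  finally show "degree (h (lookup p e) * (\<Prod>i\<in>keys e. f i ^ lookup e i)) \<le> total_degree p" .
qed simp

section \<open>Nonvanishing points\<close>

text \<open>Induction on the number of variables: \<open>p\<close> is read as a polynomial in the
  last one. A nonvanishing point of some nonzero coefficient leaves a nonzero univariate polynomial,
  which has finitely many roots in an infinite field.\<close>

lemma exists_nonzero_point:
  fixes p :: "'a::field_char_0 mpoly"
  assumes "p \<in> mpolys m" "p \<noteq> 0"
  shows "\<exists>a. ev (\<lambda>c. c) a p \<noteq> 0"
  using assms
proof (induction m arbitrary: p)
  case 0
  then have "p = Const (lookup p 0)"
    by (intro poly_mapping_eqI) (auto simp: Const_def lookup_single when_def mpolys_def in_keys_iff)
  then have "ev (\<lambda>c. c) (\<lambda>_. 0) p = lookup p 0" "lookup p 0 \<noteq> 0"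
    using ev_Const[OF is_hom_id, of "\<lambda>_. 0" "lookup p 0"] \<open>p \<noteq> 0\<close> by auto
  then show ?case by (intro exI[of _ "\<lambda>_. 0"]) simp
next
  case (Suc m)
  define q where "q = ev (\<lambda>c. [:Const c:]) (\<lambda>i. if i = m then [:0, 1:] else [:Var i:]) p"
  have hC: "is_hom (\<lambda>c::'a. [:Const c:])"
    by (rule is_hom_comp[OF is_hom_pCons is_hom_Const])
  have coeffs: "coeff q j \<in> mpolys m" for j
    unfolding q_def using Suc.prems(1)
  proof (induction arbitrary: j rule: mpolys_induct)
    case (Const c)
    then show ?case using hC by (cases j) auto
  next
    case (Var i)
    then show ?case using hC
      by (cases j; cases "j - 1") auto
  next
    case (add p q)
    then show ?case using hC by (auto simp: ev_add mpolys_add)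
  next
    case (mult p q)
    then show ?case using hC by (auto simp: ev_mult coeff_mult intro!: mpolys_sum mpolys_mult)
  qed
  \<comment> \<open>Substituting the last variable back recovers \<open>p\<close>, so
    \<open>q\<close> is not zero.\<close>
  have "poly q (Var m) = ev Const Var p"
    unfolding q_def hom_ev[OF is_hom_poly] by (intro ev_cong[OF Suc.prems(1)] arg_cong3[where f=ev]) 
      (auto intro!: arg_cong2[where f="\<lambda>h f. ev h f p"])
  then have "q \<noteq> 0" using \<open>p \<noteq> 0\<close> by auto
  then obtain j where "coeff q j \<noteq> 0" by (auto simp: poly_eq_iff)
  then obtain a where a: "ev (\<lambda>c. c) a (coeff q j) \<noteq> 0" using Suc.IH coeffs by blast
  \<comment> \<open>\<open>r\<close> is \<open>q\<close> with its coefficients evaluated at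
    \<open>a\<close>.\<close>
  define r where "r = ev (\<lambda>c. [:c:]) (\<lambda>i. if i = m then [:0, 1:] else [:a i:]) p"
  have "coeff r j = ev (\<lambda>c. c) a (coeff q j)" for j
    unfolding q_def r_def
  proof (induction p arbitrary: j rule: mpoly_induct)
    case (Const c)
    then show ?case using hC by (cases j) auto
  next
    case (Var i)
    then show ?case using hC hom_one[OF is_hom_ev[OF is_hom_id], of a]
      by (cases j; cases "j - 1") auto
  next
    case (add p q)
    then show ?case using hC by (auto simp: ev_add)
  next
    case (mult p q)
    then show ?case using hC by (auto simp: ev_mult coeff_mult ev_sum)
  qed
  then have "r \<noteq> 0" using a by auto
  then have "finite {x. poly r x = 0}" by (rule poly_roots_finite)
  then have "{x. poly r x = 0} \<noteq> UNIV" using infinite_UNIV_char_0 by metis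
  then obtain x where "poly r x \<noteq> 0" by auto
  moreover have "poly r x = ev (\<lambda>c. c) (\<lambda>i. if i = m then x else a i) p"
    unfolding r_def hom_ev[OF is_hom_poly] by (intro arg_cong2[where f="\<lambda>h f. ev h f p"]) auto
  ultimately show ?case by metis
qed

text \<open>Polynomials over a field form an integral domain, so a nonvanishing point of the product
  serves all factors. This supplies the generic points below.\<close>

lemma exists_common_nonzero_point:
  fixes S :: "'a::field_char_0 mpoly set"
  assumes "finite S" "0 \<notin> S"
  shows "\<exists>a. \<forall>p\<in>S. ev (\<lambda>c. c) a p \<noteq> 0"
proof -
  have "\<Prod>S \<noteq> 0" using assms by (simp add: prod_zero_iff)
  moreover obtain m where "\<Prod>S \<in> mpolys m" using ex_mpolys by blast
  ultimately obtain a where "ev (\<lambda>c. c) a (\<Prod>S) \<noteq> 0" using exists_nonzero_point by blast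
  then show ?thesis
    using assms(1) by (auto simp: hom_prod[OF is_hom_ev[OF is_hom_id]] prod_zero_iff)
qed

section \<open>Derivatives\<close>

text \<open>The truncated subtraction disappears in this form: a monomial without the variable
  \<open>i\<close> contributes the coefficient zero.\<close>

lemma lookup_pderiv:
  "lookup (pderiv_mpoly i p) e = of_nat (lookup e i + 1) * lookup p (e + single i 1)"
proof -
  have inj: "e' - single i 1 = e \<longleftrightarrow> e' = e + single i 1" if "lookup e' i \<noteq> 0" for e' :: monom
    using that single_minus_plus[of i e'] by (auto simp: in_keys_iff add.commute)
  have "lookup (pderiv_mpoly i p) e =
      (\<Sum>e'\<in>keys p. (of_nat (lookup e' i) * lookup p e' when e' - single i 1 = e))"
    by (simp add: pderiv_mpoly_def lookup_sum lookup_single)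
  also have "\<dots> = (\<Sum>e'\<in>keys p. (of_nat (lookup e' i) * lookup p e' when e' = e + single i 1))"
  proof (intro sum.cong refl)
    fix e'
    show "(of_nat (lookup e' i) * lookup p e' when e' - single i 1 = e) =
        (of_nat (lookup e' i) * lookup p e' when e' = e + single i 1)"
      using inj[of e'] by (cases "lookup e' i = 0") (simp_all add: when_def)
  qed
  also have "\<dots> = of_nat (lookup e i + 1) * lookup p (e + single i 1)"
    by (simp add: when_def sum.delta in_keys_iff lookup_add)
  finally show ?thesis .
qed

lemma pderiv_commute: "pderiv_mpoly i (pderiv_mpoly j p) = pderiv_mpoly j (pderiv_mpoly i p)"
  by (rule poly_mapping_eqI)
    (cases "i = j", auto simp: lookup_pderiv lookup_add lookup_single add_ac mult_ac)

lemma pderiv_add: "pderiv_mpoly i (p + q) = pderiv_mpoly i p + pderiv_mpoly i q"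
  by (rule poly_mapping_eqI) (simp add: lookup_pderiv lookup_add algebra_simps)

lemma pderiv_zero [simp]: "pderiv_mpoly i 0 = 0"
  by (rule poly_mapping_eqI) (simp add: lookup_pderiv)

lemma pderiv_sum: "pderiv_mpoly i (sum f A) = (\<Sum>x\<in>A. pderiv_mpoly i (f x))"
  by (induction A rule: infinite_finite_induct) (auto simp: pderiv_add)

lemma pderiv_single:
  "pderiv_mpoly i (single e c) = single (e - single i 1) (of_nat (lookup e i) * c)"
  by (cases "c = 0") (simp_all add: pderiv_mpoly_def)

lemma pderiv_single_mult:
  "pderiv_mpoly i (single e c * single e' c') =
    pderiv_mpoly i (single e c) * single e' c' + single e c * pderiv_mpoly i (single e' c')"
proof -
  \<comment> \<open>If \<open>u\<close> lacks the variable \<open>i\<close>, truncation spoils the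
    exponents, but then both coefficients are zero.\<close>
  have *: "single (u - single i 1) (of_nat (lookup u i) * x) * single u' y =
      single (u + u' - single i 1) (of_nat (lookup u i) * (x * y))" for u u' :: monom and x y :: 'a
  proof (cases "lookup u i = 0")
    case False
    then have "u - single i 1 + u' = u + u' - single i 1"
      by (intro poly_mapping_eqI) (auto simp: lookup_add lookup_minus lookup_single when_def)
    then show ?thesis by (simp add: mult_single mult.assoc)
  qed simp
  have "single e c * single (e' - single i 1) (of_nat (lookup e' i) * c') =
      single (e + e' - single i 1) (of_nat (lookup e' i) * (c * c'))"
    using *[of e' c' e c] by (simp add: mult_ac add_ac)
  then show ?thesis
    using *[of e c e' c'] unfolding mult_single pderiv_single
    by (simp add: lookup_add distrib_left mult_ac single_add)
qed

lemma pderiv_mult: "pderiv_mpoly i (p * q) = pderiv_mpoly i p * q + p * pderiv_mpoly i q"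
proof -
  have "p * q = (\<Sum>e\<in>keys p. \<Sum>e'\<in>keys q. single e (lookup p e) * single e' (lookup q e'))"
    by (subst mpoly_eq_sum_single[of p], subst mpoly_eq_sum_single[of q]) (simp add: sum_product)
  then have "pderiv_mpoly i (p * q) =
      (\<Sum>e\<in>keys p. pderiv_mpoly i (single e (lookup p e))) * (\<Sum>e'\<in>keys q. single e' (lookup q e')) +
      (\<Sum>e\<in>keys p. single e (lookup p e)) * (\<Sum>e'\<in>keys q. pderiv_mpoly i (single e' (lookup q e')))"
    by (simp add: pderiv_sum pderiv_single_mult sum.distrib sum_product)
  then show ?thesis
    by (simp flip: mpoly_eq_sum_single pderiv_sum)
qed

lemma pderiv_Const [simp]: "pderiv_mpoly i (Const c) = 0"
  by (simp add: Const_def pderiv_single)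

lemma pderiv_Var: "pderiv_mpoly i (Var j) = (if i = j then 1 else 0)"
  by (simp add: Var_def pderiv_single lookup_single)

lemma pderiv_in_mpolys:
  assumes "p \<in> mpolys m"
  shows "pderiv_mpoly i p \<in> mpolys m"
proof -
  have "p \<in> mpolys m \<and> pderiv_mpoly i p \<in> mpolys m"
    using assms by (induction rule: mpolys_induct)
      (auto simp: pderiv_add pderiv_mult pderiv_Var mpolys_add mpolys_mult)
  then show ?thesis ..
qed

lemma funpow_pderiv_commute:
  "pderiv_mpoly i ((pderiv_mpoly j ^^ l) p) = (pderiv_mpoly j ^^ l) (pderiv_mpoly i p)"
  by (induction l) (auto simp: pderiv_commute[of i j])

lemma fold_pderiv_commute:
  "pderiv_mpoly i (fold (\<lambda>j. pderiv_mpoly j ^^ l j) xs p) =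
    fold (\<lambda>j. pderiv_mpoly j ^^ l j) xs (pderiv_mpoly i p)"
  by (induction xs arbitrary: p) (auto simp: funpow_pderiv_commute)

lemma iterated_pderiv_0 [simp]: "iterated_pderiv k 0 p = p"
proof -
  have "fold (\<lambda>j. pderiv_mpoly j ^^ 0) xs p = p" for xs by (induction xs) auto
  then show ?thesis by (simp add: iterated_pderiv_def)
qed

text \<open>Partial derivatives commute, so the extra one can be moved out of the middle of the
  fold.\<close>

lemma iterated_pderiv_Suc:
  fixes p :: "'a::comm_semiring_1 mpoly"
  assumes "i < k"
  shows "iterated_pderiv k (e + single i 1) p = pderiv_mpoly i (iterated_pderiv k e p)"
proof -
  let ?f = "\<lambda>e. fold (\<lambda>j. pderiv_mpoly j ^^ lookup e j)"
  have "?f (e + single i 1) xs p = ?f e xs p" if "i \<notin> set xs" for xs and p :: "'a mpoly"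
    using that by (induction xs arbitrary: p) (auto simp: lookup_add lookup_single when_def)
  moreover have "?f (e + single i 1) xs p = pderiv_mpoly i (?f e xs p)"
    if "i \<in> set xs" "distinct xs" for xs and p :: "'a mpoly"
    using that
  proof (induction xs arbitrary: p)
    case (Cons x xs)
    show ?case
    proof (cases "x = i")
      case True
      then show ?thesis using Cons.prems calculation[of xs]
        by (simp add: lookup_add lookup_single fold_pderiv_commute)
    next
      case False
      then show ?thesis using Cons by (simp add: lookup_add lookup_single)
    qed
  qed simp
  ultimately show ?thesis using assms by (simp add: iterated_pderiv_def)
qed

lemma iterated_pderiv_in_mpolys:
  assumes "p \<in> mpolys m"
  shows "iterated_pderiv k e p \<in> mpolys m"
proof -
  have pow: "(pderiv_mpoly j ^^ l) q \<in> mpolys m" if "q \<in> mpolys m" for j l and q :: "'a mpoly"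
    using that by (induction l) (auto simp: pderiv_in_mpolys)
  have "fold (\<lambda>j. pderiv_mpoly j ^^ lookup e j) xs p \<in> mpolys m" for xs
    using assms by (induction xs arbitrary: p) (auto simp: pow)
  then show ?thesis by (simp add: iterated_pderiv_def)
qed

text \<open>A nonconstant monomial contains some variable; the derivative in it keeps the
  coefficient up to a positive integer factor, which is nonzero in characteristic zero.\<close>

lemma exists_pderiv_nonzero:
  fixes p :: "'a::field_char_0 mpoly"
  assumes "p \<in> mpolys k" "total_degree p > 0"
  shows "\<exists>i<k. pderiv_mpoly i p \<noteq> 0"
proof -
  have "\<exists>e\<in>keys p. e \<noteq> 0"
  proof (rule ccontr)
    assume "\<not> ?thesis"
    then have "monom_degree ` keys p \<subseteq> {0}" by (auto simp: monom_degree_def)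
    then have *: "insert 0 (monom_degree ` keys p) = {0}" by auto
    show False using assms(2) unfolding total_degree_def * by simp
  qed
  then obtain e i where e: "e \<in> keys p" and i: "i \<in> keys e" using monom_nonzero_keys by blast
  have "e - single i 1 + single i 1 = e" using single_minus_plus[OF i] by (simp add: add.commute)
  then have "lookup (pderiv_mpoly i p) (e - single i 1) \<noteq> 0"
    unfolding lookup_pderiv using e by (simp add: in_keys_iff del: of_nat_add of_nat_Suc)
  moreover have "i < k" using e i assms(1) by (auto simp: mpolys_def)
  ultimately show ?thesis by force
qed

lemma total_degree_Const [simp]: "total_degree (Const c) = 0"
  by (simp add: total_degree_def Const_def monom_degree_def)

section \<open>Straight-line programs\<close>

text \<open>The polynomials in \<open>A\<close> are available for free.\<close>

inductive slp :: "'a::comm_semiring_1 mpoly set \<Rightarrow> 'a mpoly set \<Rightarrow> bool" for A where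
  slp_empty: "slp A {}"
| slp_const: "slp A X \<Longrightarrow> slp A (insert (Const c) X)"
| slp_plus: "slp A X \<Longrightarrow> es \<noteq> [] \<Longrightarrow> snd ` set es \<subseteq> A \<union> X \<Longrightarrow>
    slp A (insert (sum_list (map (\<lambda>(c, u). Const c * u) es)) X)"
| slp_times: "slp A X \<Longrightarrow> es \<noteq> [] \<Longrightarrow> snd ` set es \<subseteq> A \<union> X \<Longrightarrow>
    slp A (insert (prod_list (map (\<lambda>(c, u). Const c * u) es)) X)"

text \<open>Gates are counted as a set of polynomials: a repeated result is charged once, and
  everything computed stays available, which makes the cost additive under composition.\<close>

definition cost :: "'a::comm_semiring_1 mpoly set \<Rightarrow> nat \<Rightarrow> 'a mpoly set \<Rightarrow> bool" where
  "cost A s S \<longleftrightarrow> (\<exists>X. slp A X \<and> card X \<le> s \<and> S \<subseteq> A \<union> X)"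

section \<open>Composition of programs and the cost of basic operations\<close>

lemma slp_finite: "slp A X \<Longrightarrow> finite X"
  by (induction rule: slp.induct) auto

lemma slp_mono: "slp A X \<Longrightarrow> A \<subseteq> A' \<Longrightarrow> slp A' X"
proof (induction rule: slp.induct)
  case (slp_plus X es)
  then show ?case by (intro slp.slp_plus) auto
next
  case (slp_times X es)
  then show ?case by (intro slp.slp_times) auto
qed (auto intro: slp.intros)

lemma slp_trans: "slp (A \<union> X) Y \<Longrightarrow> slp A X \<Longrightarrow> slp A (Y \<union> X)"
proof (induction rule: slp.induct)
  case (slp_const Y c)
  then show ?case using slp.slp_const[of A "Y \<union> X" c] by simp
next
  case (slp_plus Y es)
  then show ?case using slp.slp_plus[of A "Y \<union> X" es] by (simp add: Un_ac)
next
  case (slp_times Y es)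
  then show ?case using slp.slp_times[of A "Y \<union> X" es] by (simp add: Un_ac)
qed simp

lemma cost_trans:
  assumes "cost A s S" "cost (A \<union> S) t T"
  shows "cost A (s + t) (S \<union> T)"
proof -
  obtain X where X: "slp A X" "card X \<le> s" "S \<subseteq> A \<union> X"
    using assms(1) by (auto simp: cost_def)
  obtain Y where Y: "slp (A \<union> S) Y" "card Y \<le> t" "T \<subseteq> A \<union> S \<union> Y"
    using assms(2) by (auto simp: cost_def)
  have "slp (A \<union> X) Y" using Y(1) by (rule slp_mono) (use X in auto)
  then have "slp A (Y \<union> X)" using X(1) by (rule slp_trans)
  moreover have "card (Y \<union> X) \<le> s + t" using card_Un_le[of Y X] X Y by linarith
  ultimately show ?thesis using X Y unfolding cost_def by (intro exI[of _ "Y \<union> X"]) auto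
qed

lemma cost_mono:
  assumes "cost A s S" "A \<subseteq> A'" "s \<le> s'" "S' \<subseteq> A' \<union> S"
  shows "cost A' s' S'"
proof -
  obtain X where X: "slp A X" "card X \<le> s" "S \<subseteq> A \<union> X"
    using assms(1) by (auto simp: cost_def)
  then show ?thesis using slp_mono[OF X(1) assms(2)] assms
    unfolding cost_def by (intro exI[of _ X]) auto
qed

lemma cost_trans':
  assumes "cost A s S" "cost (A \<union> S) t T" "s + t \<le> r" "R \<subseteq> A \<union> S \<union> T"
  shows "cost A r R"
  by (rule cost_mono[OF cost_trans[OF assms(1,2)]]) (use assms in auto)

lemma cost_available: "S \<subseteq> A \<Longrightarrow> cost A s S"
  unfolding cost_def by (intro exI[of _ "{}"]) (auto intro: slp_empty)

lemma cost_Un: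
  assumes "cost A s S" "cost A t T"
  shows "cost A (s + t) (S \<union> T)"
  by (rule cost_trans[OF assms(1) cost_mono[OF assms(2)]]) auto

lemma cost_UN:
  assumes "finite I" "\<And>i. i \<in> I \<Longrightarrow> cost A t (S i)"
  shows "cost A (card I * t) (\<Union>i\<in>I. S i)"
  using assms by (induction I rule: finite_induct) (auto intro: cost_available cost_Un)

lemma cost_Const: "cost A 1 {Const c}"
  unfolding cost_def using slp_const[OF slp_empty, of A c] by (intro exI[of _ "{Const c}"]) auto

lemma cost_plus:
  assumes "es \<noteq> []" "snd ` set es \<subseteq> A"
  shows "cost A 1 {sum_list (map (\<lambda>(c, u). Const c * u) es)}"
  unfolding cost_def using slp_plus[OF slp_empty, of es A] assms
  by (intro exI[of _ "{sum_list (map (\<lambda>(c, u). Const c * u) es)}"]) auto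

lemma cost_times:
  assumes "es \<noteq> []" "snd ` set es \<subseteq> A"
  shows "cost A 1 {prod_list (map (\<lambda>(c, u). Const c * u) es)}"
  unfolding cost_def using slp_times[OF slp_empty, of es A] assms
  by (intro exI[of _ "{prod_list (map (\<lambda>(c, u). Const c * u) es)}"]) auto

lemma cost_lincomb:
  assumes "finite I" "u ` I \<subseteq> A"
  shows "cost A 1 {\<Sum>i\<in>I. Const (c i) * u i}"
proof (cases "I = {}")
  case True
  then show ?thesis using cost_Const[of A 0] by simp
next
  case False
  obtain xs where xs: "distinct xs" "set xs = I" using finite_distinct_list assms(1) by blast
  have "sum_list (map (\<lambda>(c, u). Const c * u) (map (\<lambda>i. (c i, u i)) xs)) = (\<Sum>i\<in>I. Const (c i) * u i)"
    using xs by (simp add: o_def sum.distinct_set_conv_list flip: xs(2))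
  then show ?thesis
    using cost_plus[of "map (\<lambda>i. (c i, u i)) xs" A] xs False assms by (force simp: image_image)
qed

lemma cost_mult: "u \<in> A \<Longrightarrow> v \<in> A \<Longrightarrow> cost A 1 {u * v}"
  using cost_times[of "[(1, u), (1, v)]" A] by simp

lemma cost_smult: "u \<in> A \<Longrightarrow> cost A 1 {Const c * u}"
  using cost_times[of "[(c, u)]" A] by simp

text \<open>One gate per product and one for the sum; the scalars sit on edges.\<close>

lemma cost_convolution:
  assumes "finite I" "u ` I \<subseteq> A" "v ` I \<subseteq> A"
  shows "cost A (card I + 1) {\<Sum>i\<in>I. Const (c i) * (u i * v i)}"
proof (rule cost_trans'[where S = "\<Union>i\<in>I. {u i * v i}"])
  show "cost A (card I * 1) (\<Union>i\<in>I. {u i * v i})"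
    using assms by (intro cost_UN cost_mult) auto
  show "cost (A \<union> (\<Union>i\<in>I. {u i * v i})) 1 {\<Sum>i\<in>I. Const (c i) * (u i * v i)}"
    using assms by (intro cost_lincomb) auto
qed auto

lemma cost_convolution_add:
  assumes "finite I" "u ` I \<subseteq> A" "v ` I \<subseteq> A" "w \<in> A"
  shows "cost A (card I + 1) {Const c' * w + (\<Sum>i\<in>I. Const (c i) * (u i * v i))}"
proof (rule cost_trans'[where S = "\<Union>i\<in>I. {u i * v i}"])
  show "cost A (card I * 1) (\<Union>i\<in>I. {u i * v i})"
    using assms by (intro cost_UN cost_mult) auto
  \<comment> \<open>The index \<open>None\<close> stands for the extra summand \<open>w\<close>,
    which thus enters the same addition gate without a gate of its own.\<close>
  let ?f = "\<lambda>j. case j of None \<Rightarrow> w | Some i \<Rightarrow> u i * v i"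
  let ?c = "\<lambda>j. case j of None \<Rightarrow> c' | Some i \<Rightarrow> c i"
  have "(\<Sum>j\<in>insert None (Some ` I). Const (?c j) * ?f j) =
      Const c' * w + (\<Sum>i\<in>I. Const (c i) * (u i * v i))"
    using assms(1) by (subst sum.insert) (auto simp: sum.reindex)
  moreover have "cost (A \<union> (\<Union>i\<in>I. {u i * v i})) 1 {\<Sum>j\<in>insert None (Some ` I). Const (?c j) * ?f j}"
    using assms by (intro cost_lincomb) auto
  ultimately show "cost (A \<union> (\<Union>i\<in>I. {u i * v i})) 1 {Const c' * w + (\<Sum>i\<in>I. Const (c i) * (u i * v i))}"
    by simp
qed auto

text \<open>The nodes are numbered in order of creation, the variables first; edges then run from
  smaller to larger numbers, which will give acyclicity.\<close>

lemma slp_imp_circuit: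
  assumes "slp (Var ` {..<k}) X"
  shows "\<exists>N lab val. N \<le> k + card X \<and> Var ` {..<k} \<union> X \<subseteq> val ` {..<N} \<and>
    (\<forall>v<N. gate_ok k (lab v) \<and> snd ` set (in_edges (lab v)) \<subseteq> {..<v} \<and> val v = gate_value val (lab v))"
proof -
  define Q where "Q X \<longleftrightarrow> (\<exists>N lab val. N \<le> k + card X \<and> Var ` {..<k} \<union> X \<subseteq> val ` {..<N} \<and>
    (\<forall>v<N. gate_ok k (lab v) \<and> snd ` set (in_edges (lab v)) \<subseteq> {..<v} \<and> val v = gate_value val (lab v)))"
    for X :: "'a mpoly set"
  \<comment> \<open>Shared by the three kinds of gates. A polynomial already present gets no new
    node, in agreement with counting by cardinality.\<close>
  have add_gate: "Q (insert p X)" if Q: "Q X" and fin: "finite X" and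
    gate: "\<And>N val. Var ` {..<k} \<union> X \<subseteq> val ` {..<N} \<Longrightarrow>
      \<exists>g. gate_ok k g \<and> snd ` set (in_edges g) \<subseteq> {..<N::nat} \<and> p = gate_value val g"
    for p and X :: "'a mpoly set"
  proof (cases "p \<in> X")
    case True
    then show ?thesis using Q by (simp add: insert_absorb)
  next
    case False
    obtain N lab val where N: "N \<le> k + card X" "Var ` {..<k} \<union> X \<subseteq> val ` {..<N}"
      and val: "\<And>v. v < N \<Longrightarrow> gate_ok k (lab v) \<and> snd ` set (in_edges (lab v)) \<subseteq> {..<v} \<and>
        val v = gate_value val (lab v)"
      using Q unfolding Q_def by blast
    obtain g where g: "gate_ok k g" "snd ` set (in_edges g) \<subseteq> {..<N}" "p = gate_value val g"
      using gate[OF N(2)] by blast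
    let ?lab = "lab(N := g)" and ?val = "val(N := p)"
    have "gate_ok k (?lab v) \<and> snd ` set (in_edges (?lab v)) \<subseteq> {..<v} \<and>
        ?val v = gate_value ?val (?lab v)" if "v < Suc N" for v
    proof (cases "v = N")
      case True
      have "gate_value ?val g = gate_value val g"
        using g(2) by (intro gate_value_cong) auto
      then show ?thesis using True g by simp
    next
      case False
      then have "v < N" using that by simp
      moreover have "gate_value ?val (lab v) = gate_value val (lab v)"
        using val[OF \<open>v < N\<close>] \<open>v < N\<close> by (intro gate_value_cong) auto
      ultimately show ?thesis using val by simp
    qed
    moreover have "Suc N \<le> k + card (insert p X)" using N(1) False fin by simp
    moreover have "Var ` {..<k} \<union> insert p X \<subseteq> ?val ` {..<Suc N}"
    proof
      fix q assume q: "q \<in> Var ` {..<k} \<union> insert p X"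
      show "q \<in> ?val ` {..<Suc N}"
      proof (cases "q = p")
        case True
        then show ?thesis by (intro image_eqI[of _ _ N]) auto
      next
        case False
        then obtain v where "v < N" "q = val v" using N(2) q by auto
        then show ?thesis by (intro image_eqI[of _ _ v]) auto
      qed
    qed
    ultimately show ?thesis unfolding Q_def by blast
  qed
  \<comment> \<open>Edges of a program start at polynomials; in a circuit they have to start at
    nodes computing them.\<close>
  have index: "\<exists>es'. es' \<noteq> [] \<and> snd ` set es' \<subseteq> {..<N} \<and>
      map (\<lambda>(c, u). Const c * val u) es' = map (\<lambda>(c, u). Const c * u) es"
    if "es \<noteq> []" "snd ` set es \<subseteq> Var ` {..<k} \<union> X" "Var ` {..<k} \<union> X \<subseteq> val ` {..<N}"
    for es X N and val :: "nat \<Rightarrow> 'a mpoly"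
  proof -
    have "\<forall>q\<in>snd ` set es. \<exists>v<N. val v = q" using that by force
    then obtain idx where idx: "\<And>q. q \<in> snd ` set es \<Longrightarrow> idx q < N \<and> val (idx q) = q" by metis
    then have idx: "idx u < N \<and> val (idx u) = u" if "(c, u) \<in> set es" for c u
      using that image_eqI[of u snd "(c, u)" "set es"] by simp
    let ?es = "map (\<lambda>(c, u). (c, idx u)) es"
    have "map (\<lambda>(c, u). Const c * val u) ?es = map (\<lambda>(c, u). Const c * u) es"
      using idx by (auto simp: case_prod_unfold)
    moreover have "snd ` set ?es \<subseteq> {..<N}" using idx by (auto simp: case_prod_unfold)
    ultimately show ?thesis using that(1) by (intro exI[of _ ?es]) (simp del: map_map)
  qed
  have "Q X" using assms
  proof (induction rule: slp.induct)
    case slp_empty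
    have "k \<le> k + card {} \<and> Var ` {..<k} \<union> {} \<subseteq> (Var ` {..<k} :: 'a mpoly set) \<and>
        (\<forall>v<k. gate_ok k (Var_Leaf v) \<and> snd ` set (in_edges (Var_Leaf v)) \<subseteq> {..<v} \<and>
          (Var v :: 'a mpoly) = gate_value Var (Var_Leaf v))"
      by simp
    then show ?case unfolding Q_def
      by - (rule exI[of _ k], rule exI[of _ Var_Leaf], rule exI[of _ Var])
  next
    case (slp_const X c)
    show ?case
    proof (rule add_gate)
      show "\<exists>g. gate_ok k g \<and> snd ` set (in_edges g) \<subseteq> {..<N} \<and> Const c = gate_value val g"
        for N and val :: "nat \<Rightarrow> 'a mpoly"
        by (rule exI[of _ "Const_Leaf c"]) simp
    qed (use slp_const slp_finite in auto)
  next
    case (slp_plus X es)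
    show ?case
    proof (rule add_gate)
      fix N val assume sub: "Var ` {..<k} \<union> X \<subseteq> val ` {..<N::nat}"
      then obtain es' where "es' \<noteq> []" "snd ` set es' \<subseteq> {..<N}"
        "map (\<lambda>(c, u). Const c * val u) es' = map (\<lambda>(c, u). Const c * u) es"
        using index[OF slp_plus.hyps(2,3) sub] by (elim exE conjE)
      then show "\<exists>g. gate_ok k g \<and> snd ` set (in_edges g) \<subseteq> {..<N} \<and>
          sum_list (map (\<lambda>(c, u). Const c * u) es) = gate_value val g"
        by (intro exI[of _ "Plus es'"]) (simp del: map_eq_conv)
    qed (use slp_plus slp_finite in auto)
  next
    case (slp_times X es)
    show ?case
    proof (rule add_gate)
      fix N val assume sub: "Var ` {..<k} \<union> X \<subseteq> val ` {..<N::nat}"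
      then obtain es' where "es' \<noteq> []" "snd ` set es' \<subseteq> {..<N}"
        "map (\<lambda>(c, u). Const c * val u) es' = map (\<lambda>(c, u). Const c * u) es"
        using index[OF slp_times.hyps(2,3) sub] by (elim exE conjE)
      then show "\<exists>g. gate_ok k g \<and> snd ` set (in_edges g) \<subseteq> {..<N} \<and>
          prod_list (map (\<lambda>(c, u). Const c * u) es) = gate_value val g"
        by (intro exI[of _ "Times es'"]) (simp del: map_eq_conv)
    qed (use slp_times slp_finite in auto)
  qed
  then show ?thesis unfolding Q_def .
qed

text \<open>The summand \<open>k\<close> pays for the variable leaves, which are free for the
  program.\<close>

lemma cost_imp_computable:
  assumes "cost (Var ` {..<k}) s {p}"
  shows "computable_in_size k (k + s) p"
proof -
  obtain X where X: "slp (Var ` {..<k}) X" "card X \<le> s" "p \<in> Var ` {..<k} \<union> X"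
    using assms by (auto simp: cost_def)
  obtain N lab val where N: "N \<le> k + card X" "Var ` {..<k} \<union> X \<subseteq> val ` {..<N}"
    and val: "\<And>v. v < N \<Longrightarrow> gate_ok k (lab v) \<and> snd ` set (in_edges (lab v)) \<subseteq> {..<v} \<and>
      val v = gate_value val (lab v)"
    using slp_imp_circuit[OF X(1)] by blast
  obtain r where r: "r < N" "p = val r" using N(2) X(3) by auto
  define G where "G = \<lparr>nodes = {..<N}, label = lab, out = r\<rparr>"
  have less: "u < v \<and> v < N" if "(u, v) \<in> circuit_edges G" for u v
    using that val by (fastforce simp: circuit_edges_def G_def)
  have "circuit_edges G \<subseteq> {(u, v). u < v}" using less by blast
  then have "acyclic (circuit_edges G)"
    using acyclic_subset wf_acyclic[OF wf_less] by metis
  then have "is_circuit k G"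
    using r val less unfolding is_circuit_def by (force simp: G_def)
  moreover have "computes G p"
    using val r unfolding computes_def circuit_valuation_def
    by (intro exI[of _ val]) (auto simp: G_def)
  moreover have "circuit_size G \<le> k + s" using N(1) X(2) by (simp add: circuit_size_def G_def)
  ultimately show ?thesis unfolding computable_in_size_def by blast
qed

text \<open>A program can follow the nodes in topological order. The induction runs over sets
  \<open>V\<close> closed under predecessors and removes a node without successors in
  \<open>V\<close>.\<close>

lemma cost_nodes:
  assumes G: "is_circuit m G"
    and step: "\<And>v. v \<in> nodes G \<Longrightarrow>
      cost (A \<union> (\<Union>u\<in>snd ` set (in_edges (label G v)). S u)) t (S v)"
  shows "cost A (card (nodes G) * t) (\<Union>v\<in>nodes G. S v)"
proof -
  let ?E = "circuit_edges G"
  have fin: "finite (nodes G)" and E: "?E \<subseteq> nodes G \<times> nodes G" "acyclic ?E"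
    using G unfolding is_circuit_def by blast+
  have "finite ?E" using E(1) fin finite_subset by blast
  then have wf: "wf (?E\<inverse>)" using E(2) by (rule finite_acyclic_wf_converse)
  have "cost A (card V * t) (\<Union>v\<in>V. S v)"
    if "V \<subseteq> nodes G" "\<And>u v. (u, v) \<in> ?E \<Longrightarrow> v \<in> V \<Longrightarrow> u \<in> V" for V
    using that
  proof (induction "card V" arbitrary: V)
    case 0
    then have "V = {}" using fin finite_subset card_0_eq by metis
    then show ?case by (simp add: cost_available)
  next
    case (Suc c)
    then obtain x where "x \<in> V" by fastforce
    then obtain v where v: "v \<in> V" "\<And>u. (v, u) \<in> ?E \<Longrightarrow> u \<notin> V"
      using wfE_min[OF wf] by (metis converse_iff)
    let ?V = "V - {v}"
    have finV: "finite V" using Suc.prems fin finite_subset by blast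
    have "c = card ?V" using Suc.hyps(2) v(1) finV by simp
    then have IH: "cost A (card ?V * t) (\<Union>v\<in>?V. S v)"
      using Suc.prems v by (intro Suc.hyps(1)) auto
    have "snd ` set (in_edges (label G v)) \<subseteq> ?V"
    proof
      fix u assume "u \<in> snd ` set (in_edges (label G v))"
      then have uv: "(u, v) \<in> ?E" using v(1) Suc.prems(1) by (auto simp: circuit_edges_def)
      then have "u \<in> V" using Suc.prems(2) v(1) by blast
      moreover have "u \<noteq> v" using uv v by blast
      ultimately show "u \<in> ?V" by blast
    qed
    then have "cost (A \<union> (\<Union>v\<in>?V. S v)) t (S v)"
      using v(1) Suc.prems(1) by (intro cost_mono[OF step[of v]]) auto
    with IH show ?case
    proof (rule cost_trans')
      have "card V = Suc (card ?V)" using \<open>c = card ?V\<close> Suc.hyps(2) by simp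
      then show "card ?V * t + t \<le> card V * t" by simp
    qed (use v(1) in auto)
  qed
  then show ?thesis using E(1) by blast
qed

section \<open>Logarithmic derivatives of power series\<close>

abbreviation cst :: "'a::comm_semiring_1 \<Rightarrow> 'a mpoly fps" where
  "cst \<equiv> \<lambda>c. fps_const (Const c)"

lemma is_hom_cst [simp]: "is_hom cst"
  by (rule is_hom_comp) auto

lemma is_hom_nth_0 [simp]: "is_hom (\<lambda>f. f $ 0)"
  by (simp add: is_hom_def)

lemma Const_mult: "Const (a * b) = Const a * Const (b :: 'a::comm_semiring_1)"
  by (rule hom_mult) simp

lemma Const_add: "Const (a + b) = Const a + Const (b :: 'a::comm_semiring_1)"
  by (rule hom_add) simp

lemma Const_uminus: "Const (- a) = - Const (a :: 'a::comm_ring_1)"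
  using hom_diff[OF is_hom_Const, of 0 a] by simp

lemma Const_of_nat: "Const (of_nat n :: 'a::comm_semiring_1) = of_nat n"
  by (rule hom_of_nat) simp

lemma Const_inject [simp]: "Const a = Const b \<longleftrightarrow> a = b"
  by (metis Const_def lookup_single_eq)

lemma Const_eq_0_iff [simp]: "Const a = 0 \<longleftrightarrow> a = 0"
  using Const_inject[of a 0] by (simp del: Const_inject)

text \<open>These are the units among power series with polynomial coefficients: the constant term
  has to be a nonzero scalar, so that dividing by it is scaling on an edge.\<close>

definition fps_unit :: "'a::field_char_0 mpoly fps \<Rightarrow> bool" where
  "fps_unit W \<longleftrightarrow> (\<exists>w. w \<noteq> 0 \<and> W $ 0 = Const w)"

text \<open>The logarithmic derivative \<open>t W' / W\<close>; it is meaningful only if \<open>fps_unit W\<close>.\<close>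

definition logd :: "'a::field_char_0 mpoly fps \<Rightarrow> 'a mpoly fps" where
  "logd W = fps_XD W * fps_right_inverse W (Const (inverse (lookup (W $ 0) 0)))"

lemma fps_unit_inverse:
  assumes "fps_unit W"
  shows "W * fps_right_inverse W (Const (inverse (lookup (W $ 0) 0))) = 1"
proof (rule fps_right_inverse)
  obtain w where "w \<noteq> 0" "W $ 0 = Const w" using assms by (auto simp: fps_unit_def)
  then show "W $ 0 * Const (inverse (lookup (W $ 0) 0)) = 1"
    using Const_mult[of w "inverse w"] by (simp add: Const_def)
qed

lemma logd_eq: "fps_unit W \<Longrightarrow> logd W * W = fps_XD W"
  using fps_unit_inverse[of W] by (simp add: logd_def mult.assoc mult.commute[of _ W])

lemma logd_unique:
  assumes "fps_unit W" "L * W = fps_XD W"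
  shows "logd W = L"
proof -
  have "logd W = L * (W * fps_right_inverse W (Const (inverse (lookup (W $ 0) 0))))"
    using assms(2) by (simp add: logd_def flip: mult.assoc)
  then show ?thesis using fps_unit_inverse[OF assms(1)] by simp
qed

lemma logd_nth_0 [simp]: "logd W $ 0 = 0"
  by (simp add: logd_def)

text \<open>Compare coefficients in \<open>logd_eq\<close>; the summand for l = 0 drops out by
  \<open>logd_nth_0\<close>.\<close>

lemma logd_convolution:
  assumes "fps_unit W"
  shows "of_nat R * W $ R = (\<Sum>l=1..R. logd W $ l * W $ (R - l))"
proof -
  have "of_nat R * W $ R = (\<Sum>l=0..R. logd W $ l * W $ (R - l))"
    using arg_cong[OF logd_eq[OF assms], of "\<lambda>f. f $ R"] by (simp add: fps_mult_nth)
  then show ?thesis by (simp add: sum.atLeast_Suc_atMost)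
qed

text \<open>Solving the convolution for \<open>W $ R\<close> takes division by \<open>R\<close>,
  possible in characteristic zero. On the right \<open>W\<close> occurs only at orders below
  \<open>R\<close>.\<close>

lemma nth_from_logd:
  assumes "fps_unit W" "R \<ge> 1"
  shows "W $ R = (\<Sum>l\<in>{1..R}. Const (1 / of_nat R) * (logd W $ l * W $ (R - l)))"
proof -
  have "Const (1 / of_nat R) * (of_nat R * W $ R) = W $ R"
    using assms(2) by (simp add: Const_mult[symmetric] mult.assoc[symmetric] flip: Const_of_nat)
  then show ?thesis using logd_convolution[OF assms(1), of R] by (simp add: sum_distrib_left)
qed

text \<open>The converse conversion: the summand for l = R carries the invertible scalar
  \<open>w\<close>, and the others involve \<open>logd W\<close> at orders below \<open>R\<close>
  only.\<close>

lemma logd_from_nth: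
  assumes "w \<noteq> 0" "W $ 0 = Const w" "R \<ge> 1"
  shows "logd W $ R = Const (of_nat R / w) * W $ R +
    (\<Sum>l\<in>{1..<R}. Const (- 1 / w) * (logd W $ l * W $ (R - l)))"
proof -
  have "fps_unit W" using assms by (auto simp: fps_unit_def)
  then have "of_nat R * W $ R = (\<Sum>l=1..R. logd W $ l * W $ (R - l))"
    by (rule logd_convolution)
  also have "{1..R} = insert R {1..<R}" using assms(3) by auto
  finally have "of_nat R * W $ R = logd W $ R * Const w + (\<Sum>l\<in>{1..<R}. logd W $ l * W $ (R - l))"
    using assms(2) by simp
  then have "logd W $ R * Const w = of_nat R * W $ R - (\<Sum>l\<in>{1..<R}. logd W $ l * W $ (R - l))"
    by simp
  moreover have "logd W $ R = Const (1 / w) * (logd W $ R * Const w)"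
    using assms(1) Const_mult[of "1 / w" w] by (simp add: mult_ac)
  ultimately have "logd W $ R =
      Const (1 / w) * (of_nat R * W $ R - (\<Sum>l\<in>{1..<R}. logd W $ l * W $ (R - l)))"
    by simp
  also have "\<dots> = Const (1 / w) * of_nat R * W $ R +
      (\<Sum>l\<in>{1..<R}. - Const (1 / w) * (logd W $ l * W $ (R - l)))"
    by (simp add: right_diff_distrib sum_distrib_left sum_negf mult_ac)
  also have "Const (1 / w) * of_nat R = Const (of_nat R / w)"
    unfolding Const_of_nat[symmetric] Const_mult[symmetric] by simp
  also have "- Const (1 / w) = Const (- 1 / w)"
    by (simp flip: Const_uminus)
  finally show ?thesis .
qed

lemma fps_XD_mult: "fps_XD (f * g :: 'b::comm_ring_1 fps) = fps_XD f * g + f * fps_XD g"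
  by (simp add: fps_XD_def algebra_simps)

lemma fps_unit_mult: "fps_unit V \<Longrightarrow> fps_unit W \<Longrightarrow> fps_unit (V * W)"
  unfolding fps_unit_def by (metis Const_mult fps_mult_nth_0 mult_eq_0_iff)

lemma fps_unit_cst: "c \<noteq> 0 \<Longrightarrow> fps_unit (cst c)"
  by (auto simp: fps_unit_def)

text \<open>By uniqueness it is enough to multiply out with the product rule.\<close>

lemma logd_mult:
  assumes "fps_unit V" "fps_unit W"
  shows "logd (V * W) = logd V + logd W"
proof (rule logd_unique[OF fps_unit_mult[OF assms]])
  have "(logd V + logd W) * (V * W) = (logd V * V) * W + V * (logd W * W)"
    by (simp add: algebra_simps)
  then show "(logd V + logd W) * (V * W) = fps_XD (V * W)"
    using assms by (simp add: logd_eq fps_XD_mult)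
qed

lemma logd_cst: "c \<noteq> 0 \<Longrightarrow> logd (cst c) = 0"
  by (rule logd_unique) (auto simp: fps_unit_cst fps_XD_def)

lemma fps_unit_one: "fps_unit 1"
  using fps_unit_cst[of 1] by simp

lemma logd_one: "logd 1 = 0"
  using logd_cst[of 1] by simp

lemma fps_unit_prod_list: "(\<And>V. V \<in> set Vs \<Longrightarrow> fps_unit V) \<Longrightarrow> fps_unit (prod_list Vs)"
  by (induction Vs) (auto simp: fps_unit_one fps_unit_mult)

lemma logd_prod_list:
  "(\<And>V. V \<in> set Vs \<Longrightarrow> fps_unit V) \<Longrightarrow> logd (prod_list Vs) = sum_list (map logd Vs)"
  by (induction Vs) (auto simp: logd_one logd_mult fps_unit_prod_list)

text \<open>By the recursion \<open>logd_from_nth\<close>, the coefficient at order \<open>j\<close>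
  is determined by those of the series up to order \<open>j\<close>.\<close>

lemma logd_agree:
  assumes W: "fps_unit W" and agree: "\<And>j. j < R \<Longrightarrow> W $ j = W' $ j" and "j < R"
  shows "logd W $ j = logd W' $ j"
  using \<open>j < R\<close>
proof (induction j rule: less_induct)
  case (less j)
  obtain w where w: "w \<noteq> 0" "W $ 0 = Const w" using W by (auto simp: fps_unit_def)
  then have w': "W' $ 0 = Const w" using agree[of 0] less.prems by simp
  show ?case
  proof (cases "j = 0")
    case False
    then have "j \<ge> 1" by simp
    have "(\<Sum>l\<in>{1..<j}. Const (- 1 / w) * (logd W $ l * W $ (j - l))) =
        (\<Sum>l\<in>{1..<j}. Const (- 1 / w) * (logd W' $ l * W' $ (j - l)))"
      using less agree by (intro sum.cong) auto
    then show ?thesis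
      unfolding logd_from_nth[OF w \<open>j \<ge> 1\<close>] logd_from_nth[OF w(1) w' \<open>j \<ge> 1\<close>]
      using agree less.prems by simp
  qed simp
qed

text \<open>Truncation modulo t^R is compatible with sums and products.\<close>

lemma ev_agree:
  assumes "\<And>i j. j < R \<Longrightarrow> f i $ j = f' i $ j" "j < R"
  shows "ev cst f p $ j = ev cst f' p $ j"
  using assms(2)
proof (induction p arbitrary: j rule: mpoly_induct)
  case (mult p q)
  then show ?case by (auto simp: ev_mult fps_mult_nth intro!: sum.cong)
qed (use assms(1) in \<open>auto simp: ev_add\<close>)

lemma nth_mult_vanishing:
  fixes V :: "'b::comm_ring_1 fps"
  assumes "\<And>j. j < R \<Longrightarrow> V $ j = 0"
  shows "(V * U) $ R = V $ R * U $ 0"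
proof -
  have "(V * U) $ R = (\<Sum>i\<in>{0..R}. if i = R then V $ R * U $ 0 else 0)"
    unfolding fps_mult_nth using assms by (intro sum.cong) auto
  then show ?thesis by simp
qed

lemma sum_list_nth: "sum_list Vs $ R = sum_list (map (\<lambda>V. V $ R) Vs)"
  by (induction Vs) auto

section \<open>Coefficients of the values of the gates\<close>

text \<open>What the program stores for a gate at one order. The logarithmic derivative is included
  because a multiplication gate above may ask for it.\<close>

definition jet :: "'a::field_char_0 mpoly fps \<Rightarrow> nat \<Rightarrow> 'a mpoly set" where
  "jet W j = {W $ j} \<union> (if fps_unit W then {logd W $ j} else {})"

text \<open>The \<open>R\<close> extra gates are the R - 1 products and the sum in
  \<open>logd_from_nth\<close>.\<close>

lemma cost_jet:
  assumes "\<And>j. j < R \<Longrightarrow> jet W j \<subseteq> A" "cost A t {W $ R}" "R \<ge> 1"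
  shows "cost A (t + R) (jet W R)"
proof (cases "fps_unit W")
  case False
  then show ?thesis using assms(2) by (simp add: jet_def cost_mono)
next
  case True
  then obtain w where w: "w \<noteq> 0" "W $ 0 = Const w" by (auto simp: fps_unit_def)
  have A: "W $ j \<in> A" "logd W $ j \<in> A" if "j < R" for j
    using assms(1)[OF that] True by (auto simp: jet_def)
  have "cost (A \<union> {W $ R}) (card {1..<R} + 1) {Const (of_nat R / w) * W $ R +
    (\<Sum>l\<in>{1..<R}. Const (- 1 / w) * (logd W $ l * W $ (R - l)))}"
    using A by (intro cost_convolution_add) auto
  then have "cost (A \<union> {W $ R}) R {logd W $ R}"
    using logd_from_nth[OF w assms(3)] assms(3) by simp
  with assms(2) show ?thesis
    by (rule cost_trans') (use True in \<open>auto simp: jet_def\<close>)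
qed

text \<open>If all factors are units, \<open>logd W $ R\<close> is one addition gate and
  \<open>W $ R\<close> follows with R + 1 gates by \<open>nth_from_logd\<close>; otherwise one
  scaling gate suffices. The fan-in does not enter the cost.\<close>

lemma cost_jet_product:
  assumes "es \<noteq> []" and W: "W = prod_list (map (\<lambda>(c, u). cst c * V u) es)"
    and V: "\<And>c u. (c, u) \<in> set es \<Longrightarrow> jet (V u) R \<subseteq> A"
    and dich: "\<And>c u. (c, u) \<in> set es \<Longrightarrow> fps_unit (V u) \<or> (\<forall>j<R. V u $ j = 0)"
    and low: "\<And>j. j < R \<Longrightarrow> jet W j \<subseteq> A" and "R \<ge> 1"
  shows "cost A (R + 2) (jet W R)"
proof (cases "\<forall>(c, u)\<in>set es. c \<noteq> 0 \<and> fps_unit (V u)")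
  case True
  have units: "fps_unit U" if "U \<in> set (map (\<lambda>(c, u). cst c * V u) es)" for U
    using that True by (auto intro!: fps_unit_mult fps_unit_cst)
  have W_unit: "fps_unit W" unfolding W by (rule fps_unit_prod_list[OF units])
  have "logd W = sum_list (map logd (map (\<lambda>(c, u). cst c * V u) es))"
    unfolding W by (rule logd_prod_list[OF units])
  also have "map logd (map (\<lambda>(c, u). cst c * V u) es) = map (\<lambda>(c, u). logd (V u)) es"
    using True by (auto simp: logd_mult fps_unit_cst logd_cst)
  finally have "logd W $ R = sum_list (map (\<lambda>(c, u). Const c * u) (map (\<lambda>(c, u). (1, logd (V u) $ R)) es))"
    by (simp add: sum_list_nth o_def case_prod_unfold)
  moreover have "snd ` set (map (\<lambda>(c, u). (1::'a, logd (V u) $ R)) es) \<subseteq> A"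
    using V True by (fastforce simp: jet_def)
  ultimately have L: "cost A 1 {logd W $ R}"
    using cost_plus[of "map (\<lambda>(c, u). (1::'a, logd (V u) $ R)) es" A] \<open>es \<noteq> []\<close> by simp
  have "W $ j \<in> A" "logd W $ j \<in> A" if "j < R" for j
    using low[OF that] W_unit by (auto simp: jet_def)
  then have "cost (A \<union> {logd W $ R}) (card {1..R} + 1)
      {\<Sum>l\<in>{1..R}. Const (1 / of_nat R) * (logd W $ l * W $ (R - l))}"
    by (intro cost_convolution) (auto simp: le_less)
  then have "cost (A \<union> {logd W $ R}) (R + 1) {W $ R}"
    using nth_from_logd[OF W_unit \<open>R \<ge> 1\<close>] by simp
  with L show ?thesis
    by (rule cost_trans') (use W_unit in \<open>auto simp: jet_def\<close>)
next
  case False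
  then obtain c u where cu: "(c, u) \<in> set es" "c = 0 \<or> \<not> fps_unit (V u)" by auto
  then obtain es1 es2 where es: "es = es1 @ (c, u) # es2" by (meson split_list)
  define U where "U = prod_list (map (\<lambda>(c, u). cst c * V u) (es1 @ es2))"
  \<comment> \<open>One factor vanishes below order \<open>R\<close>, so at order \<open>R\<close> the others contribute constants.\<close>
  have "\<exists>\<gamma>. prod_list (map (\<lambda>(c, u). cst c * V u) xs) $ 0 = Const \<gamma>" if "set xs \<subseteq> set es" for xs
    using that
  proof (induction xs)
    case Nil
    show ?case by (auto intro: exI[of _ 1])
  next
    case (Cons x xs)
    obtain c u where x: "x = (c, u)" by force
    have "\<exists>w. V u $ 0 = Const w"
      using dich[of c u] Cons.prems \<open>R \<ge> 1\<close> by (force simp: x fps_unit_def intro: exI[of _ 0])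
    then show ?case using Cons by (auto simp: x simp flip: Const_mult)
  qed
  from this[of "es1 @ es2"] obtain \<gamma> where \<gamma>: "U $ 0 = Const \<gamma>" by (auto simp: U_def es)
  have vanish: "(cst c * V u) $ j = 0" if "j < R" for j
    using cu dich that by auto
  have WU: "W = (cst c * V u) * U" by (simp add: W U_def es mult_ac)
  then have "W $ R = (cst c * V u) $ R * U $ 0"
    using nth_mult_vanishing[of R "cst c * V u" U] vanish by blast
  then have "W $ R = Const (c * \<gamma>) * V u $ R" by (simp add: \<gamma> Const_mult mult_ac)
  moreover have "V u $ R \<in> A" using V cu by (auto simp: jet_def)
  ultimately have "cost A 1 {W $ R}" using cost_smult by metis
  \<comment> \<open>\<open>W\<close> is then no unit, and its jet consists of this one
    coefficient.\<close>
  moreover have "W $ 0 = 0" using WU vanish[of 0] \<open>R \<ge> 1\<close> by simp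
  then have "\<not> fps_unit W" by (auto simp: fps_unit_def)
  ultimately show ?thesis by (auto simp: jet_def intro: cost_mono)
qed

text \<open>Leaves and sums take one gate plus the \<open>R\<close> of \<open>cost_jet\<close>,
  products are \<open>cost_jet_product\<close>. \<open>dich\<close> expresses that the expansion
  point is generic; vanishing is asked only below \<open>R\<close> because erasing an input
  coefficient at \<open>R\<close> may create a nonzero term there.\<close>

lemma cost_circuit_jets:
  fixes G :: "'a::field_char_0 circuit"
  assumes G: "is_circuit m G" and val: "circuit_valuation G val" and "R \<ge> 1"
    and leaf: "\<And>i. i < m \<Longrightarrow> cost A 1 {f i $ R}"
    and dich: "\<And>v. v \<in> nodes G \<Longrightarrow> fps_unit (ev cst f (val v)) \<or> (\<forall>j<R. ev cst f (val v) $ j = 0)"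
    and low: "\<And>v j. v \<in> nodes G \<Longrightarrow> j < R \<Longrightarrow> jet (ev cst f (val v)) j \<subseteq> A"
  shows "cost A (card (nodes G) * (R + 2)) (\<Union>v\<in>nodes G. jet (ev cst f (val v)) R)"
proof (rule cost_nodes[OF G])
  fix v assume v: "v \<in> nodes G"
  let ?W = "\<lambda>v. ev cst f (val v)"
  let ?A = "A \<union> (\<Union>u\<in>snd ` set (in_edges (label G v)). jet (?W u) R)"
  have W: "?W v = ev cst f (gate_value val (label G v))"
    using val v by (simp add: circuit_valuation_def)
  have ok: "gate_ok m (label G v)" using G v by (simp add: is_circuit_def)
  have "circuit_edges G \<subseteq> nodes G \<times> nodes G" using G unfolding is_circuit_def by blast
  then have child: "u \<in> nodes G" if "(c, u) \<in> set (in_edges (label G v))" for c u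
    using that v by (force simp: circuit_edges_def)
  have low': "jet (?W v) j \<subseteq> ?A" if "j < R" for j using low[OF v that] by blast
  have simple: "cost ?A (R + 2) (jet (?W v) R)" if "cost ?A 1 {?W v $ R}"
    by (rule cost_mono[OF cost_jet[OF low' that \<open>R \<ge> 1\<close>]]) auto
  show "cost ?A (R + 2) (jet (?W v) R)"
  proof (cases "label G v")
    case (Var_Leaf i)
    have "cost ?A 1 {f i $ R}" using ok Var_Leaf by (intro cost_mono[OF leaf[of i]]) auto
    then show ?thesis using W Var_Leaf by (intro simple) simp
  next
    case (Const_Leaf c)
    have "?W v $ R = Const 0" using W Const_Leaf \<open>R \<ge> 1\<close> by simp
    then have "cost ?A 1 {?W v $ R}" using cost_Const by metis
    then show ?thesis by (rule simple)
  next
    case (Plus es)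
    have "?W v = sum_list (map (\<lambda>(c, u). cst c * ?W u) es)"
      unfolding W Plus by (simp add: hom_sum_list[OF is_hom_ev] case_prod_unfold ev_mult)
    then have "?W v $ R = sum_list (map (\<lambda>(c, u). Const c * u) (map (\<lambda>(c, u). (c, ?W u $ R)) es))"
      by (simp add: sum_list_nth o_def case_prod_unfold)
    moreover have "snd ` set (map (\<lambda>(c, u). (c, ?W u $ R)) es) \<subseteq> ?A"
      unfolding Plus by (force simp: jet_def)
    moreover have "es \<noteq> []" using ok Plus by simp
    ultimately have "cost ?A 1 {?W v $ R}"
      using cost_plus[of "map (\<lambda>(c, u). (c, ?W u $ R)) es" ?A] by simp
    then show ?thesis by (rule simple)
  next
    case (Times es)
    show ?thesis
    proof (rule cost_jet_product[where V = ?W and es = es])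
      show "es \<noteq> []" using ok Times by simp
      show "?W v = prod_list (map (\<lambda>(c, u). cst c * ?W u) es)"
        unfolding W Times by (simp add: hom_prod_list[OF is_hom_ev] case_prod_unfold ev_mult)
      show "jet (?W u) R \<subseteq> ?A" if "(c, u) \<in> set es" for c u
        using that unfolding Times by force
      show "fps_unit (?W u) \<or> (\<forall>j<R. ?W u $ j = 0)" if "(c, u) \<in> set es" for c u
        using dich child that Times by auto
    qed (use low' \<open>R \<ge> 1\<close> in auto)
  qed
qed

section \<open>Reconstruction of the polynomial\<close>

text \<open>The polynomial along the line a + (z - a)t; its coefficient at t^j is the homogeneous
  part of degree j in z - a.\<close>

definition fps_shift_at :: "(nat \<Rightarrow> 'a) \<Rightarrow> 'a mpoly \<Rightarrow> 'a::field_char_0 mpoly fps" where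
  "fps_shift_at a = ev cst (\<lambda>i. cst (a i) + fps_const (Var i - Const (a i)) * fps_X)"

lemma is_hom_fps_shift_at: "is_hom (fps_shift_at a)"
  unfolding fps_shift_at_def by (rule is_hom_ev) simp

lemma fps_shift_at_Const [simp]: "fps_shift_at a (Const c) = cst c"
  by (simp add: fps_shift_at_def)

lemma fps_shift_at_nth_0: "fps_shift_at a p $ 0 = Const (ev (\<lambda>c. c) a p)"
  unfolding fps_shift_at_def by (simp add: hom_ev[OF is_hom_nth_0] hom_ev[OF is_hom_Const])

text \<open>Chain rule along that line, checked on constants, variables, sums and products.\<close>

lemma fps_deriv_shift_at:
  assumes "p \<in> mpolys k"
  shows "fps_deriv (fps_shift_at a p) =
    (\<Sum>i<k. fps_const (Var i - Const (a i)) * fps_shift_at a (pderiv_mpoly i p))"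
  using assms
proof (induction rule: mpolys_induct)
  case (Const c)
  then show ?case by (simp add: hom_zero[OF is_hom_fps_shift_at])
next
  case (Var i)
  have "(\<Sum>j<k. fps_const (Var j - Const (a j)) * fps_shift_at a (pderiv_mpoly j (Var i))) =
      (\<Sum>j<k. if j = i then fps_const (Var i - Const (a i)) else 0)"
    by (intro sum.cong) (auto simp: pderiv_Var hom_one[OF is_hom_fps_shift_at] hom_zero[OF is_hom_fps_shift_at])
  also have "\<dots> = fps_deriv (fps_shift_at a (Var i))"
    using Var by (simp add: fps_shift_at_def)
  finally show ?case by simp
next
  case (add p q)
  then show ?case
    by (simp add: pderiv_add hom_add[OF is_hom_fps_shift_at] distrib_left sum.distrib)
next
  case (mult p q)
  then show ?case
    by (simp add: pderiv_mult hom_add[OF is_hom_fps_shift_at] hom_mult[OF is_hom_fps_shift_at]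
        distrib_left sum.distrib sum_distrib_left sum_distrib_right mult_ac)
qed

text \<open>The expansion is a polynomial in t of degree at most \<open>d\<close>, and its value at
  t = 1 is \<open>p\<close>.\<close>

lemma sum_fps_shift_at:
  fixes p :: "'a::field_char_0 mpoly"
  assumes "total_degree p \<le> d"
  shows "(\<Sum>j\<le>d. fps_shift_at a p $ j) = p"
proof -
  define q where "q = ev (\<lambda>c. [:Const c:]) (\<lambda>i. [:Const (a i), Var i - Const (a i):]) p"
  have "fps_shift_at a p = fps_of_poly q"
    unfolding q_def fps_shift_at_def hom_ev[OF is_hom_fps_of_poly]
    by (simp add: fps_of_poly_pCons fps_of_poly_const mult.commute)
  moreover have "degree q \<le> d"
    unfolding q_def by (rule order_trans[OF degree_ev_le]) (use assms in auto)
  moreover have "poly q 1 = p"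
    unfolding q_def by (simp add: hom_ev[OF is_hom_poly])
  ultimately show ?thesis
    by (auto simp: poly_altdef intro!: sum.mono_neutral_left[symmetric] le_degree)
qed

section \<open>Exponent vectors of bounded degree\<close>

definition expdeg :: "nat \<Rightarrow> monom \<Rightarrow> nat" where
  "expdeg k e = (\<Sum>j<k. lookup e j)"

definition exps :: "nat \<Rightarrow> nat \<Rightarrow> monom set" where
  "exps k n = (\<Union>i\<le>n. exponents k i)"

lemma finite_exps [simp]: "finite (exps k n)"
  by (simp add: exps_def finite_exponents)

lemma exponents_iff: "e \<in> exponents k i \<longleftrightarrow> keys e \<subseteq> {..<k} \<and> expdeg k e = i"
  by (simp add: exponents_def expdeg_def)

lemma exps_iff: "e \<in> exps k n \<longleftrightarrow> keys e \<subseteq> {..<k} \<and> expdeg k e \<le> n"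
  by (auto simp: exps_def exponents_iff)

lemma exponents_Suc:
  assumes "e \<in> exponents k i" "x < k"
  shows "e + single x 1 \<in> exponents k (Suc i)"
proof -
  have "keys (e + single x 1) \<subseteq> {..<k}"
    using assms Poly_Mapping.keys_add[of e "single x 1"] by (auto simp: exponents_def)
  moreover have "expdeg k (e + single x 1) = Suc (expdeg k e)"
    using assms(2) by (simp add: expdeg_def lookup_add lookup_single when_def sum.distrib)
  ultimately show ?thesis using assms(1) by (simp add: exponents_iff)
qed

text \<open>Each of the \<open>k\<close> exponents lies between 0 and \<open>n\<close>; this crude
  box count fits the final bound.\<close>

lemma card_exps_le: "card (exps k n) \<le> (n + 1) ^ k"
proof -
  let ?f = "\<lambda>e. restrict (lookup e) {..<k}"
  have "inj_on ?f (exps k n)"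
  proof (rule inj_onI)
    fix e e' assume e: "e \<in> exps k n" "e' \<in> exps k n" "?f e = ?f e'"
    show "e = e'"
    proof (rule poly_mapping_eqI)
      fix i
      have "lookup e i = 0" "lookup e' i = 0" if "\<not> i < k"
        using that e(1,2) by (auto simp: exps_iff in_keys_iff subset_iff)
      then show "lookup e i = lookup e' i"
        using fun_cong[OF e(3), of i] by (cases "i < k") auto
    qed
  qed
  moreover have "?f ` exps k n \<subseteq> PiE {..<k} (\<lambda>_. {..n})"
  proof
    fix g assume "g \<in> ?f ` exps k n"
    then obtain e where e: "e \<in> exps k n" "g = ?f e" by blast
    have "lookup e i \<le> n" if "i < k" for i
      using member_le_sum[of i "{..<k}" "lookup e"] that e(1) by (auto simp: exps_iff expdeg_def)
    then show "g \<in> PiE {..<k} (\<lambda>_. {..n})" using e(2) by auto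
  qed
  ultimately have "card (exps k n) \<le> card (PiE {..<k} (\<lambda>_. {..n}))"
    by (intro card_inj_on_le finite_PiE) auto
  then show ?thesis by (simp add: card_PiE)
qed

text \<open>The factor y^e / e! of the generator, taken at y = b.\<close>

definition taylor_monom :: "nat \<Rightarrow> (nat \<Rightarrow> 'a) \<Rightarrow> monom \<Rightarrow> 'a::field_char_0" where
  "taylor_monom k b e = (\<Prod>j<k. b j ^ lookup e j) / (\<Prod>j<k. fact (lookup e j))"

locale reconstruction_data =
  fixes k n :: nat and P :: "'a::field_char_0 mpoly" and \<beta> a :: "nat \<Rightarrow> 'a"
begin

definition dser :: "monom \<Rightarrow> 'a mpoly fps" where
  "dser e = fps_shift_at a (iterated_pderiv k e P)"

text \<open>The expansion of \<open>Delta k P i\<close> at y = b along the line through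
  \<open>a\<close>.\<close>

definition tser :: "(nat \<Rightarrow> 'a) \<Rightarrow> nat \<Rightarrow> 'a mpoly fps" where
  "tser b i = (\<Sum>e\<in>exponents k i. cst (taylor_monom k b e) * dser e)"

text \<open>The inputs on which the circuit of \<open>C\<close> is run. The scalar \<open>c\<close>
  displaces the root at index \<open>n\<close> and serves as an interpolation node for derivatives
  in that argument.\<close>

definition inser :: "(nat \<Rightarrow> 'a) \<Rightarrow> 'a \<Rightarrow> nat \<Rightarrow> 'a mpoly fps" where
  "inser b c i = (if i < n then tser b i else if i = n then tser b n + cst c else cst (\<beta> i))"

text \<open>The erased coefficient is the one that is still unknown at stage \<open>R\<close>.\<close>

definition inser_erased :: "nat \<Rightarrow> (nat \<Rightarrow> 'a) \<Rightarrow> 'a \<Rightarrow> nat \<Rightarrow> 'a mpoly fps" where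
  "inser_erased R b c =
    (inser b c)(n := tser b n + (cst c - fps_const (tser b n $ R) * fps_X ^ R))"

lemma tser_nth: "tser b i $ R = (\<Sum>e\<in>exponents k i. Const (taylor_monom k b e) * dser e $ R)"
  by (simp add: tser_def fps_sum_nth)

lemma inser_nth_0: "\<exists>w. inser b c i $ 0 = Const w"
proof -
  have "tser b i $ 0 = Const (\<Sum>e\<in>exponents k i. taylor_monom k b e * ev (\<lambda>c. c) a (iterated_pderiv k e P))" for i
    by (simp add: tser_nth dser_def fps_shift_at_nth_0 hom_sum[OF is_hom_Const] Const_mult)
  then show ?thesis
    by (auto simp: inser_def simp flip: Const_add)
qed

lemma inser_erased_nth:
  assumes "j < R"
  shows "inser b c i $ j = inser_erased R b c i $ j"
  using assms by (auto simp: inser_erased_def inser_def fps_X_power_mult_right_nth)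

lemma inser_erased_nth_R:
  assumes "R \<ge> 1"
  shows "inser_erased R b c i $ R = (if i < n then tser b i $ R else 0)"
  using assms by (auto simp: inser_erased_def inser_def fps_X_power_mult_right_nth)

lemma inser_nth_R:
  assumes "R \<ge> 1"
  shows "inser b c i $ R = (if i \<le> n then tser b i $ R else 0)"
  using assms by (auto simp: inser_def)

end

text \<open>\<open>interp\<close> recovers the derivatives of order \<open>n\<close> from the points
  in \<open>B\<close>, \<open>dich\<close> is the genericity of \<open>a\<close>, and
  \<open>solve\<close> expresses the unknown coefficient by circuit outputs on erased inputs. The
  weights \<open>\<mu>\<close> and \<open>\<rho>\<close> are scalars and sit on edges.\<close>

locale reconstruction = reconstruction_data +
  fixes G :: "'a::field_char_0 circuit" and val :: "nat \<Rightarrow> 'a mpoly" and m :: nat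
    and B :: "(nat \<Rightarrow> 'a) set" and \<Gamma> :: "'a set" and \<mu> :: "monom \<Rightarrow> (nat \<Rightarrow> 'a) \<Rightarrow> 'a"
    and \<rho> :: "(nat \<Rightarrow> 'a) \<Rightarrow> 'a \<Rightarrow> 'a"
  assumes P: "P \<in> mpolys k"
    and G: "is_circuit m G" and val: "circuit_valuation G val"
    and fin: "finite B" "finite \<Gamma>"
    and interp: "\<And>e e'. e \<in> exponents k n \<Longrightarrow> e' \<in> exponents k n \<Longrightarrow>
      (\<Sum>b\<in>B. \<mu> e b * taylor_monom k b e') = (if e' = e then 1 else 0)"
    and dich: "\<And>b c v. b \<in> B \<Longrightarrow> c \<in> \<Gamma> \<Longrightarrow> v \<in> nodes G \<Longrightarrow>
      fps_unit (ev cst (inser b c) (val v)) \<or> ev cst (inser b c) (val v) = 0"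
    and solve: "\<And>b R. b \<in> B \<Longrightarrow> R \<ge> 1 \<Longrightarrow>
      tser b n $ R = (\<Sum>c\<in>\<Gamma>. Const (\<rho> b c) * ev cst (inser_erased R b c) (val (out G)) $ R)"
begin

section \<open>The program and its invariant\<close>

definition shifted_vars :: "'a mpoly set" where
  "shifted_vars = (\<lambda>i. Var i - Const (a i)) ` {..<k}"

text \<open>
  The coefficients of \<open>dser e\<close> that come from the homogeneous part of \<open>P\<close> of degree \<open>q\<close>.
\<close>

definition level :: "nat \<Rightarrow> 'a mpoly set" where
  "level q = (\<lambda>e. dser e $ (q - expdeg k e)) ` {e \<in> exps k n. expdeg k e \<le> q}"

definition node_jets :: "nat \<Rightarrow> 'a mpoly set" where
  "node_jets j = (\<Union>b\<in>B. \<Union>c\<in>\<Gamma>. \<Union>v\<in>nodes G. jet (ev cst (inser b c) (val v)) j)"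

text \<open>The invariant after stage \<open>R\<close>: the parts of \<open>P\<close> up to degree n
  + R, together with the jets of all gates up to order \<open>R\<close>, the lower order data of the
  next stage.\<close>

definition known :: "nat \<Rightarrow> 'a mpoly set" where
  "known R = shifted_vars \<union> (\<Union>q\<le>n + R. level q) \<union> (\<Union>j\<le>R. node_jets j)"

abbreviation "N \<equiv> card (exps k n)"

abbreviation "gates \<equiv> card (nodes G)"

text \<open>Compare coefficients at t^(j-1) in \<open>fps_deriv_shift_at\<close>. The identity
  trades one derivative for one more order in t.\<close>

lemma euler:
  assumes "j \<ge> 1"
  shows "dser e $ j =
    (\<Sum>x\<in>{..<k}. Const (1 / of_nat j) * ((Var x - Const (a x)) * dser (e + single x 1) $ (j - 1)))"
proof -
  have "of_nat j * dser e $ j = fps_deriv (dser e) $ (j - 1)"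
    using assms by simp
  also have "\<dots> = (\<Sum>x<k. (Var x - Const (a x)) * dser (e + single x 1) $ (j - 1))"
    unfolding dser_def
    by (subst fps_deriv_shift_at[OF iterated_pderiv_in_mpolys[OF P]])
      (simp add: fps_sum_nth iterated_pderiv_Suc del: One_nat_def)
  finally have *: "of_nat j * dser e $ j =
      (\<Sum>x<k. (Var x - Const (a x)) * dser (e + single x 1) $ (j - 1))" .
  have "Const (1 / of_nat j) * (of_nat j * dser e $ j) = dser e $ j"
    using assms by (simp add: Const_mult[symmetric] mult.assoc[symmetric] flip: Const_of_nat)
  then show ?thesis unfolding * by (simp add: sum_distrib_left)
qed

text \<open>Descent by Euler's identity from the derivatives of highest order, with k + 1 gates
  each. A part of degree q < n has nonzero derivatives only up to order q, hence the
  minimum.\<close>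

lemma cost_level:
  assumes vars: "shifted_vars \<subseteq> A"
    and top: "\<And>e. e \<in> exponents k (min n q) \<Longrightarrow> dser e $ (q - min n q) \<in> A"
  shows "cost A (N * (k + 1)) (level q)"
proof -
  define t where "t = min n q"
  \<comment> \<open>\<open>E i\<close> holds the exponents reached after \<open>i\<close>
    descents.\<close>
  define E where "E i = (\<Union>l\<in>{t - i..t}. exponents k l)" for i
  have finE: "finite (E i)" for i by (simp add: E_def finite_exponents)
  have "cost A (card (E i) * (k + 1)) ((\<lambda>e. dser e $ (q - expdeg k e)) ` E i)" if "i \<le> t" for i
    using that
  proof (induction i)
    case 0
    have "(\<lambda>e. dser e $ (q - expdeg k e)) ` E 0 \<subseteq> A"
      using top by (auto simp: E_def t_def exponents_iff)
    then show ?case by (rule cost_available)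
  next
    case (Suc i)
    define l where "l = t - Suc i"
    let ?A = "A \<union> (\<lambda>e. dser e $ (q - expdeg k e)) ` E i"
    let ?L = "exponents k l"
    have E_Suc: "E (Suc i) = ?L \<union> E i" and disj: "?L \<inter> E i = {}"
    proof -
      have "{t - Suc i..t} = insert l {t - i..t}" using Suc.prems by (auto simp: l_def)
      then show "E (Suc i) = ?L \<union> E i" by (simp add: E_def)
      show "?L \<inter> E i = {}" using Suc.prems by (auto simp: E_def l_def exponents_iff)
    qed
    have "cost ?A (k + 1) {dser e $ (q - expdeg k e)}" if e: "e \<in> ?L" for e
    proof -
      have l: "expdeg k e = l" using e by (simp add: exponents_iff)
      have "q - l \<ge> 1" using Suc.prems by (simp add: l_def t_def)
      have "dser (e + single x 1) $ (q - l - 1) \<in> ?A" if "x < k" for x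
      proof -
        have *: "e + single x 1 \<in> exponents k (Suc l)" using e that by (rule exponents_Suc)
        moreover have "Suc l \<in> {t - i..t}" using Suc.prems by (auto simp: l_def)
        ultimately have "e + single x 1 \<in> E i" unfolding E_def by blast
        moreover have "expdeg k (e + single x 1) = Suc l" using * by (simp add: exponents_iff)
        ultimately show ?thesis by (intro UnI2 image_eqI[of _ _ "e + single x 1"]) auto
      qed
      then have "cost ?A (card {..<k} + 1) {\<Sum>x\<in>{..<k}. Const (1 / of_nat (q - l)) *
          ((Var x - Const (a x)) * dser (e + single x 1) $ (q - l - 1))}"
        using vars by (intro cost_convolution) (auto simp: shifted_vars_def)
      then show ?thesis using euler[OF \<open>q - l \<ge> 1\<close>, of e] by (simp add: l)
    qed
    then have "cost ?A (card ?L * (k + 1)) (\<Union>e\<in>?L. {dser e $ (q - expdeg k e)})"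
      by (intro cost_UN finite_exponents) auto
    with Suc.IH show ?case
    proof (rule cost_trans')
      show "card (E i) * (k + 1) + card ?L * (k + 1) \<le> card (E (Suc i)) * (k + 1)"
        unfolding E_Suc using disj finE
        by (subst card_Un_disjoint) (auto simp: finite_exponents algebra_simps)
    qed (use Suc.prems E_Suc in auto)
  qed
  from this[of t] have "cost A (card (E t) * (k + 1)) ((\<lambda>e. dser e $ (q - expdeg k e)) ` E t)" by simp
  then show ?thesis
  proof (rule cost_mono)
    have "E t \<subseteq> exps k n" by (auto simp: E_def exps_def t_def)
    then show "card (E t) * (k + 1) \<le> N * (k + 1)" by (intro mult_right_mono card_mono) auto
    have "{e \<in> exps k n. expdeg k e \<le> q} \<subseteq> E t"
      by (auto simp: E_def exps_iff exponents_iff t_def)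
    then show "level q \<subseteq> A \<union> (\<lambda>e. dser e $ (q - expdeg k e)) ` E t"
      unfolding level_def by blast
  qed simp
qed

lemma cost_pairs:
  assumes "\<And>b c. b \<in> B \<Longrightarrow> c \<in> \<Gamma> \<Longrightarrow> cost A t (S b c)"
  shows "cost A (card B * card \<Gamma> * t) (\<Union>b\<in>B. \<Union>c\<in>\<Gamma>. S b c)"
  unfolding mult.assoc using assms fin by (intro cost_UN) auto

text \<open>At order 0 all derivatives and gate values are scalars, one gate each; Euler's identity
  completes the levels up to \<open>n\<close>.\<close>

lemma cost_init:
  "cost (Var ` {..<k}) (k + 2 + (n + 1) * (N * (k + 2)) + card B * card \<Gamma> * gates) (known 0)"
proof -
  \<comment> \<open>The constant 1 lets \<open>Var i - Const (a i)\<close> be one addition gate; 0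
    is the constant term of every logarithmic derivative.\<close>
  have const: "cost (Var ` {..<k}) 2 {1, 0 :: 'a mpoly}"
    using cost_Un[OF cost_Const[of _ 1] cost_Const[of _ 0]] by (simp add: insert_commute numeral_2_eq_2)
  let ?A = "Var ` {..<k} \<union> {1, 0 :: 'a mpoly}"
  have "cost ?A 1 {Var i - Const (a i)}" if "i < k" for i
    using cost_plus[of "[(1, Var i), (- a i, 1)]" ?A] that by (simp add: Const_uminus)
  then have "cost ?A (card {..<k} * 1) (\<Union>i\<in>{..<k}. {Var i - Const (a i)})"
    by (intro cost_UN) auto
  then have vars: "cost ?A k shifted_vars" by (rule cost_mono) (auto simp: shifted_vars_def)
  let ?A' = "?A \<union> shifted_vars"
  have level: "cost ?A' (N * (k + 2)) (level q)" if "q \<le> n" for q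
  proof -
    have "cost ?A' 1 {dser e $ 0}" for e
      unfolding dser_def fps_shift_at_nth_0 by (rule cost_Const)
    then have "cost ?A' (card (exponents k q) * 1) (\<Union>e\<in>exponents k q. {dser e $ 0})"
      by (intro cost_UN finite_exponents)
    moreover have "cost (?A' \<union> (\<Union>e\<in>exponents k q. {dser e $ 0})) (N * (k + 1)) (level q)"
      using that by (intro cost_level) (auto simp: min_absorb2)
    ultimately show ?thesis
    proof (rule cost_trans')
      have "card (exponents k q) \<le> N"
        using that by (intro card_mono[OF finite_exps]) (auto simp: exps_def)
      then show "card (exponents k q) * 1 + N * (k + 1) \<le> N * (k + 2)" by simp
    qed auto
  qed
  have levels: "cost ?A' ((n + 1) * (N * (k + 2))) (\<Union>q\<le>n. level q)"
    using cost_UN[of "{..n}" ?A' "N * (k + 2)" level] level by simp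
  have "cost ?A' 1 (jet (ev cst (inser b c) (val v)) 0)" for b c v
  proof -
    have "ev cst (inser b c) (val v) $ 0 = ev Const (\<lambda>i. inser b c i $ 0) (val v)"
      by (simp add: hom_ev[OF is_hom_nth_0])
    moreover obtain w where "(\<lambda>i. inser b c i $ 0) = (\<lambda>i. Const (w i))"
      using inser_nth_0[of b c] by metis
    ultimately have "ev cst (inser b c) (val v) $ 0 = Const (ev (\<lambda>c. c) w (val v))"
      by (simp add: hom_ev[OF is_hom_Const])
    then have "cost ?A' 1 {ev cst (inser b c) (val v) $ 0}" by (metis cost_Const)
    then show ?thesis by (rule cost_mono) (auto simp: jet_def)
  qed
  then have "cost ?A' (card B * card \<Gamma> * (gates * 1)) (node_jets 0)"
    unfolding node_jets_def using G by (intro cost_pairs cost_UN) (auto simp: is_circuit_def)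
  with levels have "cost ?A' ((n + 1) * (N * (k + 2)) + card B * card \<Gamma> * gates)
      ((\<Union>q\<le>n. level q) \<union> node_jets 0)"
    using cost_Un by fastforce
  with vars have "cost ?A (k + ((n + 1) * (N * (k + 2)) + card B * card \<Gamma> * gates)) (known 0)"
    by (rule cost_trans') (auto simp: known_def)
  with const show ?thesis by (rule cost_trans') auto
qed

lemma out_in_nodes: "out G \<in> nodes G"
  using G by (simp add: is_circuit_def)

text \<open>The circuit is run on erased inputs, the unknown coefficients are solved for, the
  derivatives of order \<open>n\<close> are interpolated, Euler's identity gives the new level, and
  the circuit is run again on the true inputs; hence the factor 2.\<close>

lemma cost_stage:
  assumes R: "R = Suc R'"
  shows "cost (known R') (2 * (card B * card \<Gamma> * (gates * (R + 2))) + card B + N * (k + 2)) (known R)"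
proof -
  have "R \<ge> 1" using R by simp
  let ?A0 = "known R'"
  let ?W = "\<lambda>b c v. ev cst (inser b c) (val v)"
  let ?W' = "\<lambda>b c v. ev cst (inser_erased R b c) (val v)"
  have jets: "jet (?W b c v) j \<subseteq> ?A0" if "b \<in> B" "c \<in> \<Gamma>" "v \<in> nodes G" "j < R" for b c v j
    using that R by (fastforce simp: known_def node_jets_def)
  \<comment> \<open>For i < n these coefficients come from the part of degree i + R, at most n + R',
    which is already known.\<close>
  have low: "cost ?A0 1 {tser b i $ R}" if "i < n" for b i
  proof -
    have "dser e $ R \<in> ?A0" if e: "e \<in> exponents k i" for e
    proof -
      have "e \<in> exps k n" using e \<open>i < n\<close> by (auto simp: exps_def)
      moreover have "expdeg k e = i" using e by (simp add: exponents_iff)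
      ultimately have "dser e $ R \<in> level (i + R)"
        unfolding level_def by (intro image_eqI[of _ _ e]) auto
      moreover have "i + R \<le> n + R'" using \<open>i < n\<close> R by simp
      ultimately show ?thesis unfolding known_def by blast
    qed
    then show ?thesis unfolding tser_nth by (intro cost_lincomb finite_exponents) auto
  qed
  have agree: "?W b c v $ j = ?W' b c v $ j" if "j < R" for b c v j
    using inser_erased_nth that by (intro ev_agree[of R]) auto
  \<comment> \<open>Below order \<open>R\<close> erased and true inputs agree, so the stored jets
    are the lower order data for this run too.\<close>
  have erased: "cost ?A0 (gates * (R + 2)) (\<Union>v\<in>nodes G. jet (?W' b c v) R)"
    if bc: "b \<in> B" "c \<in> \<Gamma>" for b c
  proof (rule cost_circuit_jets[OF G val \<open>R \<ge> 1\<close>])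
    show "cost ?A0 1 {inser_erased R b c i $ R}" for i
      using low[of i b] cost_Const[of ?A0 0] by (auto simp: inser_erased_nth_R[OF \<open>R \<ge> 1\<close>])
    fix v assume v: "v \<in> nodes G"
    have unit: "fps_unit (?W' b c v) \<longleftrightarrow> fps_unit (?W b c v)"
      using agree[of 0] R by (simp add: fps_unit_def)
    show "fps_unit (?W' b c v) \<or> (\<forall>j<R. ?W' b c v $ j = 0)"
      using dich[OF bc v] agree[of _ b c v] unit by (metis fps_zero_nth)
    show "jet (?W' b c v) j \<subseteq> ?A0" if "j < R" for j
    proof -
      have "jet (?W' b c v) j = jet (?W b c v) j"
        using that agree logd_agree[of "?W b c v" R "?W' b c v" j] unit by (auto simp: jet_def)
      then show ?thesis using jets[OF bc v that] by simp
    qed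
  qed
  define J where "J = (\<Union>b\<in>B. \<Union>c\<in>\<Gamma>. \<Union>v\<in>nodes G. jet (?W' b c v) R)"
  have step1: "cost ?A0 (card B * card \<Gamma> * (gates * (R + 2))) J"
    unfolding J_def by (rule cost_pairs[OF erased])
  let ?A1 = "?A0 \<union> J"
  define T where "T = (\<Union>b\<in>B. {tser b n $ R})"
  \<comment> \<open>By \<open>solve\<close>, one linear combination of the outputs collected in
    \<open>J\<close> is enough for each point.\<close>
  have "cost ?A1 1 {tser b n $ R}" if "b \<in> B" for b
    unfolding solve[OF that \<open>R \<ge> 1\<close>]
    using that out_in_nodes by (intro cost_lincomb fin) (auto simp: J_def jet_def)
  then have step2: "cost ?A1 (card B * 1) T"
    unfolding T_def by (intro cost_UN fin)
  let ?A2 = "?A1 \<union> T"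
  define D where "D = (\<Union>e\<in>exponents k n. {dser e $ R})"
  have "cost ?A2 1 {dser e $ R}" if e: "e \<in> exponents k n" for e
  proof -
    \<comment> \<open>The weights \<open>\<mu> e\<close> are dual to the Taylor monomials and
      isolate a single derivative.\<close>
    have "(\<Sum>b\<in>B. Const (\<mu> e b) * tser b n $ R) =
        (\<Sum>e'\<in>exponents k n. (\<Sum>b\<in>B. Const (\<mu> e b * taylor_monom k b e')) * dser e' $ R)"
      unfolding tser_nth sum_distrib_left sum_distrib_right
      by (subst sum.swap) (simp add: Const_mult mult.assoc)
    also have "\<dots> = (\<Sum>e'\<in>exponents k n. if e' = e then dser e $ R else 0)"
      unfolding hom_sum[OF is_hom_Const, symmetric] using interp[OF e] by (intro sum.cong) auto
    also have "\<dots> = dser e $ R" using e by (simp add: finite_exponents)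
    finally have "dser e $ R = (\<Sum>b\<in>B. Const (\<mu> e b) * tser b n $ R)" by simp
    moreover have "(\<lambda>b. tser b n $ R) ` B \<subseteq> ?A2" by (auto simp: T_def)
    ultimately show ?thesis using cost_lincomb[OF fin(1)] by simp
  qed
  then have step3: "cost ?A2 (card (exponents k n) * 1) D"
    unfolding D_def by (intro cost_UN finite_exponents)
  let ?A3 = "?A2 \<union> D"
  have step4: "cost ?A3 (N * (k + 1)) (level (n + R))"
    by (rule cost_level) (auto simp: known_def D_def)
  let ?A4 = "?A3 \<union> level (n + R)"
  \<comment> \<open>The second run, with the coefficient of order \<open>R\<close> at index
    \<open>n\<close> now available in \<open>T\<close>, restores the invariant.\<close>
  have "cost ?A4 (gates * (R + 2)) (\<Union>v\<in>nodes G. jet (?W b c v) R)" if bc: "b \<in> B" "c \<in> \<Gamma>" for b c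
  proof (rule cost_circuit_jets[OF G val \<open>R \<ge> 1\<close>])
    show "cost ?A4 1 {inser b c i $ R}" for i
    proof -
      consider "i < n" | "i = n" | "i > n" by linarith
      then show ?thesis
      proof cases
        case 1
        then show ?thesis
          using low[of i b] by (auto simp: inser_nth_R[OF \<open>R \<ge> 1\<close>] intro: cost_mono)
      next
        case 2
        then show ?thesis
          using bc by (intro cost_available) (auto simp: inser_nth_R[OF \<open>R \<ge> 1\<close>] T_def)
      next
        case 3
        then show ?thesis using cost_Const[of ?A4 0] by (simp add: inser_nth_R[OF \<open>R \<ge> 1\<close>])
      qed
    qed
    show "fps_unit (?W b c v) \<or> (\<forall>j<R. ?W b c v $ j = 0)" if "v \<in> nodes G" for v
      using dich[OF bc that] by auto
    show "jet (?W b c v) j \<subseteq> ?A4" if "v \<in> nodes G" "j < R" for v j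
      using jets[OF bc that] by blast
  qed
  then have step5: "cost ?A4 (card B * card \<Gamma> * (gates * (R + 2))) (node_jets R)"
    unfolding node_jets_def by (rule cost_pairs)
  have "cost ?A0 (card B * card \<Gamma> * (gates * (R + 2)) + card B * 1 + card (exponents k n) * 1 +
      N * (k + 1) + card B * card \<Gamma> * (gates * (R + 2)))
      (J \<union> T \<union> D \<union> level (n + R) \<union> node_jets R)"
    using step1 step2 step3 step4 step5 by (intro cost_trans) (simp_all add: Un_assoc)
  then show ?thesis
  proof (rule cost_mono)
    have "card (exponents k n) \<le> N" by (intro card_mono[OF finite_exps]) (auto simp: exps_def)
    then show "card B * card \<Gamma> * (gates * (R + 2)) + card B * 1 + card (exponents k n) * 1 +
      N * (k + 1) + card B * card \<Gamma> * (gates * (R + 2)) \<le>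
      2 * (card B * card \<Gamma> * (gates * (R + 2))) + card B + N * (k + 2)"
      by simp
    show "known R \<subseteq> ?A0 \<union> (J \<union> T \<union> D \<union> level (n + R) \<union> node_jets R)"
      by (auto simp: known_def R le_Suc_eq)
  qed simp
qed

lemma cost_stages:
  assumes "R \<le> d"
  shows "cost (known 0)
    (R * (2 * (card B * card \<Gamma> * (gates * (d + 2))) + card B + N * (k + 2))) (known R)"
  using assms
proof (induction R)
  case 0
  show ?case by (simp add: cost_available)
next
  case (Suc R)
  have stage: "cost (known R)
      (2 * (card B * card \<Gamma> * (gates * (Suc R + 2))) + card B + N * (k + 2)) (known (Suc R))"
    by (rule cost_stage) simp
  have le: "2 * (card B * card \<Gamma> * (gates * (Suc R + 2))) + card B + N * (k + 2) \<le>
      2 * (card B * card \<Gamma> * (gates * (d + 2))) + card B + N * (k + 2)"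
    using Suc.prems by (intro add_mono mult_le_mono) auto
  have step: "cost (known 0 \<union> known R)
      (2 * (card B * card \<Gamma> * (gates * (d + 2))) + card B + N * (k + 2)) (known (Suc R))"
    by (rule cost_mono[OF stage _ le]) auto
  show ?case
    by (rule cost_trans'[OF Suc.IH step]) (use Suc.prems in auto)
qed

text \<open>After \<open>d\<close> stages the homogeneous parts up to degree \<open>d\<close> are at
  hand as the coefficients for the exponent 0; one addition gate sums them to
  \<open>P\<close>.\<close>

lemma computable:
  assumes "total_degree P \<le> d"
  shows "computable_in_size k (k + (k + 2 + (n + 1) * (N * (k + 2)) + card B * card \<Gamma> * gates +
    d * (2 * (card B * card \<Gamma> * (gates * (d + 2))) + card B + N * (k + 2)) + 1)) P"
proof (rule cost_imp_computable)
  have "dser 0 $ j \<in> known d" if "j \<le> d" for j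
  proof -
    have "0 \<in> exps k n" by (simp add: exps_iff expdeg_def)
    then have "dser 0 $ j \<in> level j"
      unfolding level_def by (intro image_eqI[of _ _ 0]) (auto simp: expdeg_def)
    then show ?thesis unfolding known_def using that by auto
  qed
  then have "cost (Var ` {..<k} \<union> known 0 \<union> known d) 1 {\<Sum>j\<in>{..d}. Const 1 * dser 0 $ j}"
    by (intro cost_lincomb) auto
  moreover have "(\<Sum>j\<in>{..d}. Const 1 * dser 0 $ j) = P"
    using sum_fps_shift_at[OF assms, of a] by (simp add: dser_def)
  ultimately have last: "cost (Var ` {..<k} \<union> known 0 \<union> known d) 1 {P}" by simp
  have "cost (Var ` {..<k} \<union> known 0)
      (d * (2 * (card B * card \<Gamma> * (gates * (d + 2))) + card B + N * (k + 2))) (known d)"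
    using cost_stages[of d d] by (rule cost_mono) auto
  from cost_trans[OF cost_init this] have "cost (Var ` {..<k})
      (k + 2 + (n + 1) * (N * (k + 2)) + card B * card \<Gamma> * gates +
      d * (2 * (card B * card \<Gamma> * (gates * (d + 2))) + card B + N * (k + 2))) (known 0 \<union> known d)" .
  then show "cost (Var ` {..<k}) (k + 2 + (n + 1) * (N * (k + 2)) + card B * card \<Gamma> * gates +
    d * (2 * (card B * card \<Gamma> * (gates * (d + 2))) + card B + N * (k + 2)) + 1) {P}"
    by (rule cost_trans'[OF _ last[unfolded Un_assoc]]) auto
qed

end

section \<open>Interpolation points\<close>

text \<open>Gaussian elimination: the hypothesis says that the columns indexed by \<open>E\<close>
  are linearly independent as functions on \<open>S\<close>. Columns are added one at a time, each
  with one point.\<close>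

lemma exists_dual_points:
  fixes V :: "'b \<Rightarrow> 'e \<Rightarrow> 'a::field"
  assumes "finite E"
    and "\<And>h. (\<exists>e\<in>E. h e \<noteq> 0) \<Longrightarrow> \<exists>b\<in>S. (\<Sum>e\<in>E. h e * V b e) \<noteq> 0"
  shows "\<exists>B \<mu>. B \<subseteq> S \<and> finite B \<and> card B \<le> card E \<and>
    (\<forall>e\<in>E. \<forall>e'\<in>E. (\<Sum>b\<in>B. \<mu> e b * V b e') = (if e' = e then 1 else 0))"
  using assms
proof (induction E rule: finite_induct)
  case empty
  show ?case by (intro exI[of _ "{}"]) auto
next
  case (insert x E)
  have "\<exists>b\<in>S. (\<Sum>e\<in>E. h e * V b e) \<noteq> 0" if "\<exists>e\<in>E. h e \<noteq> 0" for h
  proof -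
    have *: "(\<Sum>e\<in>insert x E. (h(x := 0)) e * V b e) = (\<Sum>e\<in>E. h e * V b e)" for b
      using insert.hyps by (auto intro!: sum.cong)
    have "\<exists>e\<in>insert x E. (h(x := 0)) e \<noteq> 0" using that insert.hyps by auto
    from insert.prems[OF this] show ?thesis unfolding * .
  qed
  from insert.IH[OF this] obtain B \<mu> where B: "B \<subseteq> S" "finite B" "card B \<le> card E"
    and \<mu>: "\<And>e e'. e \<in> E \<Longrightarrow> e' \<in> E \<Longrightarrow> (\<Sum>b\<in>B. \<mu> e b * V b e') = (if e' = e then 1 else 0)"
    by blast
  \<comment> \<open>\<open>st e\<close> is the old functional for \<open>e\<close> applied to the
    column \<open>x\<close>, and \<open>res\<close> is that column minus the old ones with these
    coefficients. Independence yields a point \<open>b0\<close> where it does not vanish.\<close>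
  define st where "st e = (\<Sum>b\<in>B. \<mu> e b * V b x)" for e
  define res where "res b = V b x - (\<Sum>e\<in>E. st e * V b e)" for b
  have "(\<Sum>e\<in>insert x E. (if e = x then 1 else - st e) * V b e) = res b" for b
  proof -
    have "(\<Sum>e\<in>E. (if e = x then 1 else - st e) * V b e) = (\<Sum>e\<in>E. - (st e * V b e))"
      using insert.hyps by (intro sum.cong) auto
    then show ?thesis using insert.hyps by (simp add: res_def sum_negf)
  qed
  moreover have "\<exists>e\<in>insert x E. (if e = x then 1 else - st e) \<noteq> 0" by auto
  ultimately obtain b0 where b0: "b0 \<in> S" "res b0 \<noteq> 0"
    using insert.prems[of "\<lambda>e. if e = x then 1 else - st e"] by auto
  let ?B = "insert b0 B"
  define \<mu>0 where "\<mu>0 e b = (if b \<in> B then \<mu> e b else 0)" for e b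
  have \<mu>0: "(\<Sum>b\<in>?B. \<mu>0 e b * f b) = (\<Sum>b\<in>B. \<mu> e b * f b)" for e and f :: "'b \<Rightarrow> 'a"
    by (rule sum.mono_neutral_cong_right) (use B in \<open>auto simp: \<mu>0_def\<close>)
  have \<delta>: "(\<Sum>b\<in>?B. (if b = b0 then 1 else 0) * f b) = f b0" for f :: "'b \<Rightarrow> 'a"
  proof -
    have "(\<Sum>b\<in>?B. (if b = b0 then 1 else 0) * f b) = (\<Sum>b\<in>?B. if b = b0 then f b0 else 0)"
      by (intro sum.cong) auto
    then show ?thesis using B by simp
  qed
  \<comment> \<open>Evaluation at \<open>b0\<close>, corrected to vanish on the old columns and
    scaled to give 1 on the column \<open>x\<close>.\<close>
  define \<mu>x where "\<mu>x b = ((if b = b0 then 1 else 0) - (\<Sum>e\<in>E. V b0 e * \<mu>0 e b)) / res b0" for b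
  have \<mu>x_sum: "(\<Sum>b\<in>?B. \<mu>x b * V b y) = (V b0 y - (\<Sum>e\<in>E. V b0 e * (\<Sum>b\<in>B. \<mu> e b * V b y))) / res b0" for y
  proof -
    have "(\<Sum>b\<in>?B. \<mu>x b * V b y) = (\<Sum>b\<in>?B. (if b = b0 then 1 else 0) * V b y -
        (\<Sum>e\<in>E. V b0 e * (\<mu>0 e b * V b y))) / res b0"
      unfolding sum_divide_distrib
      by (intro sum.cong) (auto simp: \<mu>x_def left_diff_distrib sum_distrib_right mult.assoc)
    also have "(\<Sum>b\<in>?B. (if b = b0 then 1 else 0) * V b y - (\<Sum>e\<in>E. V b0 e * (\<mu>0 e b * V b y))) =
        V b0 y - (\<Sum>b\<in>?B. \<Sum>e\<in>E. V b0 e * (\<mu>0 e b * V b y))"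
      by (simp only: sum_subtractf \<delta>)
    also have "(\<Sum>b\<in>?B. \<Sum>e\<in>E. V b0 e * (\<mu>0 e b * V b y)) =
        (\<Sum>e\<in>E. V b0 e * (\<Sum>b\<in>B. \<mu> e b * V b y))"
      by (subst sum.swap) (simp only: sum_distrib_left[symmetric] \<mu>0)
    finally show ?thesis .
  qed
  have \<mu>x_E: "(\<Sum>b\<in>?B. \<mu>x b * V b y) = 0" if "y \<in> E" for y
  proof -
    have "(\<Sum>e\<in>E. V b0 e * (\<Sum>b\<in>B. \<mu> e b * V b y)) = (\<Sum>e\<in>E. if e = y then V b0 y else 0)"
      using \<mu> that by (intro sum.cong) auto
    then show ?thesis using that insert.hyps by (simp add: \<mu>x_sum)
  qed
  have \<mu>x_x: "(\<Sum>b\<in>?B. \<mu>x b * V b x) = 1"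
    using b0 by (simp add: \<mu>x_sum st_def[symmetric] mult.commute[of "V b0 _"] res_def[symmetric])
  \<comment> \<open>The old functionals are corrected to vanish on the column
    \<open>x\<close>.\<close>
  define \<mu>' where "\<mu>' e b = (if e = x then \<mu>x b else \<mu>0 e b - st e * \<mu>x b)" for e b
  have "(\<Sum>b\<in>?B. \<mu>' e b * V b y) = (if y = e then 1 else 0)"
    if "e \<in> insert x E" "y \<in> insert x E" for e y
  proof (cases "e = x")
    case True
    then show ?thesis using that \<mu>x_E \<mu>x_x insert.hyps by (auto simp: \<mu>'_def)
  next
    case False
    have "(\<Sum>b\<in>?B. \<mu>' e b * V b y) = (\<Sum>b\<in>?B. \<mu>0 e b * V b y) - st e * (\<Sum>b\<in>?B. \<mu>x b * V b y)"
      using False by (simp only: \<mu>'_def if_False left_diff_distrib sum_subtractf sum_distrib_left mult.assoc)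
    also have "\<dots> = (\<Sum>b\<in>B. \<mu> e b * V b y) - st e * (\<Sum>b\<in>?B. \<mu>x b * V b y)"
      by (simp only: \<mu>0)
    also have "\<dots> = (if y = e then 1 else 0)"
    proof (cases "y = x")
      case True
      have "(\<Sum>b\<in>B. \<mu> e b * V b y) = st e" by (simp only: st_def True)
      then show ?thesis using False True \<mu>x_x by simp
    next
      case y: False
      then show ?thesis using that False \<mu> \<mu>x_E[of y] by simp
    qed
    finally show ?thesis .
  qed
  moreover have "card ?B \<le> card (insert x E)"
    using card_insert_le_m1[of "Suc (card E)" B b0] B insert.hyps by simp
  ultimately show ?case
    using B b0 by (intro exI[of _ ?B] exI[of _ \<mu>'] conjI ballI) auto
qed

text \<open>Duality for the powers c^j with j at most \<open>D\<close>: they are independent because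
  a polynomial that vanishes on an infinite field is zero.\<close>

lemma exists_coefficient_functional:
  fixes D r :: nat
  assumes "r \<le> D"
  shows "\<exists>\<Gamma> w. finite \<Gamma> \<and> card \<Gamma> \<le> D + 1 \<and>
    (\<forall>j\<le>D. (\<Sum>c\<in>\<Gamma>. w c * (c :: 'a::field_char_0) ^ j) = (if j = r then 1 else 0))"
proof -
  have "\<exists>c\<in>UNIV. (\<Sum>j\<in>{..D}. h j * (c :: 'a) ^ j) \<noteq> 0" if nonzero: "\<exists>j\<in>{..D}. h j \<noteq> 0" for h
  proof (rule ccontr)
    assume "\<not> ?thesis"
    then have "\<forall>c. (\<Sum>j\<le>D. h j * c ^ j) = 0" by auto
    then have "poly (\<Sum>j\<le>D. monom (h j) j) c = 0" for c
      by (simp add: poly_sum poly_monom)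
    then have "(\<Sum>j\<le>D. monom (h j) j) = 0" using poly_all_0_iff_0 by blast
    then have "coeff (\<Sum>j\<le>D. monom (h j) j) j = 0" for j by (simp only: coeff_0)
    moreover obtain j where "j \<le> D" "h j \<noteq> 0" using nonzero by blast
    then have "coeff (\<Sum>j\<le>D. monom (h j) j) j = h j" by (simp add: coeff_sum)
    ultimately show False using \<open>h j \<noteq> 0\<close> by metis
  qed
  with finite_atMost have "\<exists>\<Gamma> \<mu>. \<Gamma> \<subseteq> UNIV \<and> finite \<Gamma> \<and> card \<Gamma> \<le> card {..D} \<and>
      (\<forall>i\<in>{..D}. \<forall>j\<in>{..D}. (\<Sum>c\<in>\<Gamma>. \<mu> i c * (c :: 'a) ^ j) = (if j = i then 1 else 0))"
    by (rule exists_dual_points[where E = "{..D}" and S = UNIV and V = "\<lambda>c j. c ^ j"])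
  then obtain \<Gamma> :: "'a set" and \<mu> where \<Gamma>: "finite \<Gamma>" "card \<Gamma> \<le> card {..D}" and
    \<mu>: "\<And>i j. i \<in> {..D} \<Longrightarrow> j \<in> {..D} \<Longrightarrow> (\<Sum>c\<in>\<Gamma>. \<mu> i c * c ^ j) = (if j = i then 1 else 0)"
    by blast
  show ?thesis
    by (rule exI[of _ \<Gamma>], rule exI[of _ "\<mu> r"]) (use \<Gamma> \<mu>[of r] assms in simp)
qed

section \<open>Specialisation of the generator\<close>

definition spec_y :: "nat \<Rightarrow> (nat \<Rightarrow> 'a) \<Rightarrow> 'a mpoly \<Rightarrow> 'a::field_char_0 mpoly" where
  "spec_y k b = ev Const (\<lambda>i. if i < k then Var i else Const (b (i - k)))"

lemma is_hom_spec_y: "is_hom (spec_y k b)"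
  unfolding spec_y_def by (rule is_hom_ev) simp

lemma spec_y_Const [simp]: "spec_y k b (Const c) = Const c"
  by (simp add: spec_y_def)

lemma spec_y_mpolys:
  assumes "p \<in> mpolys k"
  shows "spec_y k b p = p"
proof -
  have "spec_y k b p = ev Const Var p" unfolding spec_y_def by (rule ev_cong[OF assms]) simp
  then show ?thesis by simp
qed

lemma ev_spec_y: "ev (\<lambda>c. c) a (spec_y k b p) = ev (\<lambda>c. c) (\<lambda>i. if i < k then a i else b (i - k)) p"
  unfolding spec_y_def ev_ev[OF is_hom_id] by (intro arg_cong2[where f="\<lambda>f. ev (\<lambda>c. c) f"]) auto

lemma ev_spec_y_self: "ev (\<lambda>c. c) x (spec_y k (\<lambda>j. x (k + j)) p) = ev (\<lambda>c. c) x p"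
  unfolding ev_spec_y by (intro arg_cong2[where f="\<lambda>f. ev (\<lambda>c. c) f"]) auto

lemma spec_y_Delta:
  assumes "P \<in> mpolys k"
  shows "spec_y k b (Delta k P i) =
    (\<Sum>e\<in>exponents k i. Const (taylor_monom k b e) * iterated_pderiv k e P)"
proof -
  have "spec_y k b (\<Prod>j<k. Var (k + j) ^ lookup e j) = Const (\<Prod>j<k. b j ^ lookup e j)" for e
    by (simp add: hom_prod[OF is_hom_spec_y] hom_prod[OF is_hom_Const] hom_power[OF is_hom_spec_y]
        hom_power[OF is_hom_Const]) (simp add: spec_y_def)
  then show ?thesis
    unfolding Delta_def hom_sum[OF is_hom_spec_y] hom_mult[OF is_hom_spec_y]
    by (simp add: spec_y_mpolys iterated_pderiv_in_mpolys[OF assms] taylor_monom_def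
        flip: Const_mult)
qed

section \<open>The components of the generator with index 0 and 1\<close>

lemma exponents_0: "exponents k 0 = {0}"
proof -
  have "e = 0" if e: "e \<in> exponents k 0" for e
  proof (rule ccontr)
    assume "e \<noteq> 0"
    then obtain i where i: "i \<in> keys e" using monom_nonzero_keys by blast
    moreover have "i < k" using i e unfolding exponents_iff by blast
    ultimately show False using e by (simp add: exponents_iff expdeg_def in_keys_iff)
  qed
  moreover have "0 \<in> exponents k 0" by (simp add: exponents_iff expdeg_def)
  ultimately show ?thesis by blast
qed

lemma exponents_1: "exponents k 1 = (\<lambda>i. single i 1) ` {..<k}"
proof (intro equalityI subsetI)
  fix e assume e: "e \<in> exponents k 1"
  then have "e \<noteq> 0" by (auto simp: exponents_iff expdeg_def)
  then obtain i where i: "i \<in> keys e" using monom_nonzero_keys by blast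
  then have "i < k" using e by (auto simp: exponents_iff)
  define e' where "e' = e - single i 1"
  have e_eq: "e = e' + single i 1" using single_minus_plus[OF i] by (simp add: e'_def add.commute)
  have "keys e' \<subseteq> keys e" by (auto simp: e'_def in_keys_iff lookup_minus)
  moreover have "expdeg k e = Suc (expdeg k e')"
    unfolding e_eq expdeg_def using \<open>i < k\<close>
    by (simp add: lookup_add lookup_single when_def sum.distrib)
  ultimately have "e' \<in> exponents k 0" using e by (auto simp: exponents_iff)
  then have "e = single i 1" using e_eq by (simp add: exponents_0)
  then show "e \<in> (\<lambda>i. single i 1) ` {..<k}" using \<open>i < k\<close> by blast
next
  fix e assume "e \<in> (\<lambda>i. single i (1::nat)) ` {..<k}"
  then show "e \<in> exponents k 1"
    using exponents_Suc[of 0 k 0] by (auto simp: exponents_0)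
qed

lemma Delta_0: "Delta k P 0 = P"
  by (simp add: Delta_def exponents_0)

text \<open>The exponents of degree 1 are the unit vectors, so what remains is the derivative of
  \<open>P\<close> in the direction y.\<close>

lemma ev_Delta_1:
  assumes "P \<in> mpolys k"
  shows "ev (\<lambda>c. c) x (Delta k P 1) = (\<Sum>i<k. x (k + i) * ev (\<lambda>c. c) x (pderiv_mpoly i P))"
proof -
  have monom: "taylor_monom k b (single i 1) = b i" if "i < k" for i and b :: "nat \<Rightarrow> 'a"
  proof -
    have "(\<Prod>j<k. b j ^ lookup (single i 1) j) = (\<Prod>j<k. if j = i then b i else 1)"
      by (intro prod.cong) (auto simp: lookup_single when_def)
    moreover have "(\<Prod>j<k. fact (lookup (single i (1::nat)) j)) = (1::'a)"
      by (intro prod.neutral) (auto simp: lookup_single when_def)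
    ultimately show ?thesis using that by (simp add: taylor_monom_def)
  qed
  have inj: "inj_on (\<lambda>i. single i (1::nat)) {..<k}"
    by (rule inj_onI) (metis lookup_single_eq lookup_single_not_eq zero_neq_one)
  have "ev (\<lambda>c. c) x (Delta k P 1) = ev (\<lambda>c. c) x (spec_y k (\<lambda>j. x (k + j)) (Delta k P 1))"
    by (rule ev_spec_y_self[symmetric])
  also have "\<dots> = (\<Sum>e\<in>exponents k 1. taylor_monom k (\<lambda>j. x (k + j)) e * ev (\<lambda>c. c) x (iterated_pderiv k e P))"
    unfolding spec_y_Delta[OF assms] by (simp add: ev_sum ev_mult)
  also have "\<dots> = (\<Sum>i<k. x (k + i) * ev (\<lambda>c. c) x (pderiv_mpoly i P))"
    unfolding exponents_1 sum.reindex[OF inj] o_def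
  proof (rule sum.cong)
    fix i assume "i \<in> {..<k}"
    then have "i < k" by simp
    moreover have "iterated_pderiv k (single i 1) P = pderiv_mpoly i P"
      using iterated_pderiv_Suc[OF \<open>i < k\<close>, of 0 P] by (simp del: One_nat_def)
    ultimately show "taylor_monom k (\<lambda>j. x (k + j)) (single i 1) *
        ev (\<lambda>c. c) x (iterated_pderiv k (single i 1) P) = x (k + i) * ev (\<lambda>c. c) x (pderiv_mpoly i P)"
      by (simp only: monom)
  qed simp
  finally show ?thesis .
qed

text \<open>\<open>P\<close> is not constant, so the polynomials P - r for r in \<open>T\<close> are
  nonzero and have a common nonvanishing point.\<close>

lemma ev_values_not_finite:
  fixes P :: "'a::field_char_0 mpoly"
  assumes "total_degree P > 0" "finite T"
  shows "\<exists>x. ev (\<lambda>c. c) x P \<notin> T"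
proof -
  have "P \<noteq> Const r" for r using assms(1) by auto
  then have "0 \<notin> (\<lambda>r. P - Const r) ` T" by auto
  then obtain x where "\<forall>p\<in>(\<lambda>r. P - Const r) ` T. ev (\<lambda>c. c) x p \<noteq> 0"
    using exists_common_nonzero_point[of "(\<lambda>r. P - Const r) ` T"] assms(2) by blast
  then show ?thesis
    by (intro exI[of _ x]) (auto simp: hom_diff[OF is_hom_ev])
qed

text \<open>Carries the coefficients of a univariate specialisation of \<open>C\<close> from
  polynomials over to power series.\<close>

lemma coeff_ev_hom:
  assumes \<phi>: "is_hom \<phi>" and h: "is_hom h" and f: "\<And>i j. coeff (f' i) j = \<phi> (coeff (f i) j)"
  shows "coeff (ev (\<lambda>c. [:\<phi> (h c):]) f' p) j = \<phi> (coeff (ev (\<lambda>c. [:h c:]) f p) j)"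
proof -
  have hom: "is_hom (\<lambda>c. [:h c:])" "is_hom (\<lambda>c. [:\<phi> (h c):])"
    using is_hom_comp[OF is_hom_pCons h] is_hom_comp[OF is_hom_pCons is_hom_comp[OF \<phi> h]] by auto
  show ?thesis
  proof (induction p arbitrary: j rule: mpoly_induct)
    case (Const c)
    then show ?case using hom hom_zero[OF \<phi>] by (cases j) auto
  next
    case (Var i)
    then show ?case using hom f by simp
  next
    case (add p q)
    then show ?case using hom by (simp add: ev_add hom_add[OF \<phi>])
  next
    case (mult p q)
    then show ?case using hom
      by (simp add: ev_mult coeff_mult hom_sum[OF \<phi>] hom_mult[OF \<phi>])
  qed
qed

section \<open>Perturbation at a single order in t\<close>

lemma poly_eq_sum_upto:
  fixes y :: "'b::comm_ring_1"
  assumes "degree q \<le> D"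
  shows "poly q y = (\<Sum>j\<le>D. coeff q j * y ^ j)"
  unfolding poly_altdef using assms by (intro sum.mono_neutral_left) (auto intro: le_degree)

lemma power_diff_second_order:
  fixes y \<eta> :: "'b::comm_ring_1"
  shows "\<exists>u. (y - \<eta>) ^ j = y ^ j - of_nat j * y ^ (j - 1) * \<eta> + \<eta> ^ 2 * u"
proof (induction j)
  case 0
  show ?case by (intro exI[of _ 0]) simp
next
  case (Suc j)
  then obtain u where u: "(y - \<eta>) ^ j = y ^ j - of_nat j * y ^ (j - 1) * \<eta> + \<eta> ^ 2 * u" by blast
  \<comment> \<open>For j = 0 the exponent j - 1 truncates, but the factor \<open>of_nat j\<close>
    is zero.\<close>
  have y: "of_nat j * (y * y ^ (j - 1)) = of_nat j * y ^ j" by (cases j) auto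
  have "(y - \<eta>) ^ Suc j = (y - \<eta>) * (y ^ j - of_nat j * y ^ (j - 1) * \<eta> + \<eta> ^ 2 * u)"
    by (simp add: u)
  also have "\<dots> = y ^ Suc j - of_nat (Suc j) * y ^ (Suc j - 1) * \<eta> +
      \<eta> ^ 2 * (y * u + of_nat j * y ^ (j - 1) - \<eta> * u) +
      (of_nat j * y ^ j - of_nat j * (y * y ^ (j - 1))) * \<eta>"
    by (simp add: algebra_simps power2_eq_square)
  also have "\<dots> = y ^ Suc j - of_nat (Suc j) * y ^ (Suc j - 1) * \<eta> +
      \<eta> ^ 2 * (y * u + of_nat j * y ^ (j - 1) - \<eta> * u)"
    unfolding y by simp
  finally show ?case by blast
qed

text \<open>The square of x t^R has order 2R > R, so \<open>x\<close> enters at order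
  \<open>R\<close> only linearly, multiplied by a constant term.\<close>

lemma nth_mult_perturbed_power:
  fixes q :: "'a::field_char_0 mpoly fps"
  assumes "R \<ge> 1"
  shows "(q * (cst c - fps_const x * fps_X ^ R) ^ j) $ R =
    Const (c ^ j) * q $ R - Const (of_nat j * c ^ (j - 1)) * (x * q $ 0)"
proof -
  let ?\<eta> = "fps_const x * fps_X ^ R"
  obtain u where u: "(cst c - ?\<eta>) ^ j = cst c ^ j - of_nat j * cst c ^ (j - 1) * ?\<eta> + ?\<eta> ^ 2 * u"
    using power_diff_second_order by blast
  have pow: "cst c ^ i = cst (c ^ i)" for i by (simp add: hom_power[OF is_hom_cst])
  have "of_nat j * cst c ^ (j - 1) = cst (of_nat j * c ^ (j - 1))"
    unfolding hom_mult[OF is_hom_cst] hom_of_nat[OF is_hom_cst] hom_power[OF is_hom_cst] ..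
  then have "q * (cst c - ?\<eta>) ^ j =
      cst (c ^ j) * q - cst (of_nat j * c ^ (j - 1)) * (fps_const x * (fps_X ^ R * q)) +
      fps_X ^ (2 * R) * (fps_const x ^ 2 * u * q)"
    unfolding u pow by (simp add: algebra_simps power2_eq_square power_mult mult_2 power_add)
  then show ?thesis
    using assms by (simp add: fps_X_power_mult_nth)
qed

text \<open>A relation \<open>h\<close> among the Taylor monomials is a polynomial in y. A point
  where both it and \<open>A\<close> are nonzero verifies the hypothesis of
  \<open>exists_dual_points\<close> on the points that keep \<open>A\<close> alive.\<close>

lemma exists_interpolation_points:
  fixes A :: "'a::field_char_0 mpoly"
  assumes "A \<noteq> 0"
  shows "\<exists>B \<mu>. (\<forall>b\<in>B. spec_y k b A \<noteq> 0) \<and> finite B \<and> card B \<le> card (exponents k n) \<and>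
    (\<forall>e\<in>exponents k n. \<forall>e'\<in>exponents k n.
      (\<Sum>b\<in>B. \<mu> e b * taylor_monom k b e') = (if e' = e then 1 else 0))"
proof -
  have "\<exists>b\<in>{b. spec_y k b A \<noteq> 0}. (\<Sum>e\<in>exponents k n. h e * taylor_monom k b e) \<noteq> 0"
    if nonzero: "\<exists>e\<in>exponents k n. h e \<noteq> 0" for h
  proof -
    let ?F = "\<lambda>e. \<Prod>j<k. fact (lookup e j) :: 'a"
    have F: "?F e \<noteq> 0" for e by (simp add: prod_zero_iff)
    define H where "H = (\<Sum>e\<in>exponents k n. single e (h e / ?F e))"
    obtain e0 where e0: "e0 \<in> exponents k n" "h e0 \<noteq> 0" using nonzero by blast
    have "lookup H e0 = (\<Sum>e\<in>exponents k n. if e = e0 then h e0 / ?F e0 else 0)"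
      unfolding H_def lookup_sum by (intro sum.cong) (auto simp: lookup_single when_def)
    then have "lookup H e0 \<noteq> 0" using e0 F[of e0] by (simp add: finite_exponents)
    then have "H \<noteq> 0" by auto
    \<comment> \<open>Renaming moves the variables of \<open>H\<close> to the positions of y, so
      that one point serves \<open>H'\<close> and \<open>A\<close>.\<close>
    define H' where "H' = ev Const (\<lambda>j. Var (k + j)) H"
    have "ev Const (\<lambda>i. Var (i - k)) H' = ev Const Var H"
      unfolding H'_def ev_ev[OF is_hom_Const] by simp
    then have "H' \<noteq> 0" using \<open>H \<noteq> 0\<close> by auto
    then obtain x where x: "ev (\<lambda>c. c) x H' \<noteq> 0" "ev (\<lambda>c. c) x A \<noteq> 0"
      using exists_common_nonzero_point[of "{H', A}"] \<open>A \<noteq> 0\<close> by auto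
    define b where "b = (\<lambda>j. x (k + j))"
    have "ev (\<lambda>c. c) x H' = ev (\<lambda>c. c) b H"
      unfolding H'_def ev_ev[OF is_hom_id] b_def by simp
    also have "\<dots> = (\<Sum>e\<in>exponents k n. h e / ?F e * (\<Prod>i\<in>keys e. b i ^ lookup e i))"
      unfolding H_def by (simp add: ev_sum ev_single)
    also have "\<dots> = (\<Sum>e\<in>exponents k n. h e * taylor_monom k b e)"
    proof (rule sum.cong)
      fix e assume "e \<in> exponents k n"
      then have "(\<Prod>i\<in>keys e. b i ^ lookup e i) = (\<Prod>i<k. b i ^ lookup e i)"
        by (intro prod_keys_superset) (auto simp: exponents_iff)
      then show "h e / ?F e * (\<Prod>i\<in>keys e. b i ^ lookup e i) = h e * taylor_monom k b e"
        by (simp add: taylor_monom_def)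
    qed simp
    finally have "(\<Sum>e\<in>exponents k n. h e * taylor_monom k b e) \<noteq> 0" using x by simp
    moreover have "spec_y k b A \<noteq> 0"
      using x(2) ev_spec_y_self[of x k A] by (auto simp: b_def)
    ultimately show ?thesis by blast
  qed
  with finite_exponents have "\<exists>B \<mu>. B \<subseteq> {b. spec_y k b A \<noteq> 0} \<and> finite B \<and>
      card B \<le> card (exponents k n) \<and> (\<forall>e\<in>exponents k n. \<forall>e'\<in>exponents k n.
        (\<Sum>b\<in>B. \<mu> e b * taylor_monom k b e') = (if e' = e then 1 else 0))"
    by (rule exists_dual_points)
  then show ?thesis unfolding subset_iff mem_Collect_eq Ball_def[of _ "\<lambda>b. spec_y k b A \<noteq> 0"] .
qed

text \<open>The data of the locale \<open>reconstruction\<close> are produced at the critical index,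
  here called \<open>n\<close>; \<open>u\<close> and \<open>w\<close> in the conclusion are the
  numbers of points \<open>b\<close> and of displacements \<open>c\<close>.\<close>

lemma vanishing_imp_computable:
  fixes P C :: "'a::field_char_0 mpoly"
  assumes P: "P \<in> mpolys k" "total_degree P \<le> d"
    and C: "total_degree C \<le> D"
    and G: "is_circuit m G" "circuit_valuation G val" "val (out G) = C"
    and nonzero: "ev Const (\<lambda>l. if l < n then Delta k P l else Const (\<beta> l)) C \<noteq> 0"
    and zero: "ev Const (\<lambda>l. if l < Suc n then Delta k P l else Const (\<beta> l)) C = 0"
  shows "\<exists>u w. u \<le> card (exps k n) \<and> w \<le> D + 1 \<and>
    computable_in_size k (k + (k + 2 + (n + 1) * (card (exps k n) * (k + 2)) + u * w * card (nodes G) +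
      d * (2 * (u * w * (card (nodes G) * (d + 2))) + u + card (exps k n) * (k + 2)) + 1)) P"
proof -
  define f where "f y l = (if l < n then Delta k P l else if l = n then Delta k P n + y
    else Const (\<beta> l))" for y l
  \<comment> \<open>\<open>C\<close> as a polynomial in the displacement from the root
    \<open>Delta k P n\<close>; the multiplicity \<open>r\<close> of the root is the index of the
    lowest nonzero coefficient.\<close>
  define q where "q = ev (\<lambda>c. [:Const c:])
    (\<lambda>l. if l < n then [:Delta k P l:] else if l = n then [:Delta k P n, 1:] else [:Const (\<beta> l):]) C"
  have poly_q: "poly q y = ev Const (f y) C" for y
    unfolding q_def hom_ev[OF is_hom_poly]
    by (intro arg_cong2[where f="\<lambda>h f. ev h f C"] ext) (auto simp: f_def)
  have "f (Const (\<beta> n) - Delta k P n) = (\<lambda>l. if l < n then Delta k P l else Const (\<beta> l))"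
    by (auto simp: f_def fun_eq_iff)
  then have "poly q (Const (\<beta> n) - Delta k P n) \<noteq> 0" using nonzero by (simp add: poly_q)
  then have "q \<noteq> 0" by auto
  have "f 0 = (\<lambda>l. if l < Suc n then Delta k P l else Const (\<beta> l))"
    by (auto simp: f_def fun_eq_iff less_Suc_eq)
  then have "poly q 0 = 0" using zero by (simp add: poly_q)
  then have coeff_0: "coeff q 0 = 0" by (simp add: poly_0_coeff_0)
  have deg_q: "degree q \<le> D"
    unfolding q_def by (rule order_trans[OF degree_ev_le]) (use C in auto)
  define r where "r = (LEAST j. coeff q j \<noteq> 0)"
  have "\<exists>j. coeff q j \<noteq> 0" using \<open>q \<noteq> 0\<close> by (auto simp: poly_eq_iff)
  then have r: "coeff q r \<noteq> 0" unfolding r_def by (rule LeastI_ex)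
  have below_r: "coeff q j = 0" if "j < r" for j
    using not_less_Least[of j "\<lambda>j. coeff q j \<noteq> 0"] that by (auto simp: r_def)
  have "r \<ge> 1" using r coeff_0 by (cases r) auto
  have "r \<le> D" using le_degree[OF r] deg_q by simp
  \<comment> \<open>The weights read off the coefficient of degree r - 1 in the displacement, which
    is the derivative of order r - 1 up to a factorial.\<close>
  obtain \<Gamma> w where \<Gamma>: "finite \<Gamma>" "card \<Gamma> \<le> D + 1"
    and w: "\<And>j. j \<le> D \<Longrightarrow> (\<Sum>c\<in>\<Gamma>. w c * (c :: 'a) ^ j) = (if j = r - 1 then 1 else 0)"
  proof -
    have "r - 1 \<le> D" using \<open>r \<le> D\<close> by simp
    from exists_coefficient_functional[OF this] that show thesis by blast
  qed
  obtain B \<mu> where B: "\<And>b. b \<in> B \<Longrightarrow> spec_y k b (coeff q r) \<noteq> 0" "finite B"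
      "card B \<le> card (exponents k n)"
    and \<mu>: "\<And>e e'. e \<in> exponents k n \<Longrightarrow> e' \<in> exponents k n \<Longrightarrow>
      (\<Sum>b\<in>B. \<mu> e b * taylor_monom k b e') = (if e' = e then 1 else 0)"
    using exists_interpolation_points[OF r, of k n] by blast
  define \<omega> where "\<omega> b c v = spec_y k b (ev Const (f (Const c)) (val v))" for b c v
  \<comment> \<open>What must not vanish at the expansion point. Zero is removed: a gate with value
    zero falls under the second alternative of \<open>dich\<close>.\<close>
  define T where "T = ((\<lambda>b. spec_y k b (coeff q r)) ` B \<union>
    (\<Union>b\<in>B. \<Union>c\<in>\<Gamma>. \<omega> b c ` nodes G)) - {0}"
  have "finite T" using B(2) \<Gamma>(1) G(1) by (auto simp: T_def is_circuit_def)
  obtain a where a: "\<And>p. p \<in> T \<Longrightarrow> ev (\<lambda>c. c) a p \<noteq> 0"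
  proof -
    have "0 \<notin> T" by (simp add: T_def)
    from exists_common_nonzero_point[OF \<open>finite T\<close> this] that show thesis by blast
  qed
  interpret reconstruction_data k n P \<beta> a .
  define \<phi> where "\<phi> b p = fps_shift_at a (spec_y k b p)" for b p
  have hom: "is_hom (\<phi> b)" for b
    unfolding \<phi>_def by (rule is_hom_comp[OF is_hom_fps_shift_at is_hom_spec_y])
  have \<phi>_Const [simp]: "\<phi> b (Const c) = cst c" for b c by (simp add: \<phi>_def)
  have tser: "tser b i = \<phi> b (Delta k P i)" for b i
    unfolding \<phi>_def spec_y_Delta[OF P(1)] tser_def dser_def
    by (simp add: hom_sum[OF is_hom_fps_shift_at] hom_mult[OF is_hom_fps_shift_at])
  have inser: "inser b c l = \<phi> b (f (Const c) l)" for b c l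
    by (simp add: inser_def f_def tser hom_add[OF hom])
  have W: "ev cst (inser b c) (val v) = fps_shift_at a (\<omega> b c v)" for b c v
    using hom_ev[OF hom, of b Const "f (Const c)" "val v"]
    by (simp add: \<omega>_def inser[abs_def] flip: \<phi>_def)
  \<comment> \<open>Up to sign, the scalar in front of the unknown coefficient; the factor
    \<open>r\<close> comes from the linear term of the r-th power.\<close>
  define \<kappa> where "\<kappa> b = of_nat r * ev (\<lambda>c. c) a (spec_y k b (coeff q r))" for b
  have \<kappa>: "\<kappa> b \<noteq> 0" if "b \<in> B" for b
    using a[of "spec_y k b (coeff q r)"] B(1)[OF that] that \<open>r \<ge> 1\<close> by (auto simp: \<kappa>_def T_def)
  interpret reconstruction k n P \<beta> a G val m B \<Gamma> \<mu> "\<lambda>b c. - w c / \<kappa> b"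
  proof
    show "fps_unit (ev cst (inser b c) (val v)) \<or> ev cst (inser b c) (val v) = 0"
      if "b \<in> B" "c \<in> \<Gamma>" "v \<in> nodes G" for b c v
    proof (cases "\<omega> b c v = 0")
      case True
      then show ?thesis by (simp add: W hom_zero[OF is_hom_fps_shift_at])
    next
      case False
      then have "ev (\<lambda>c. c) a (\<omega> b c v) \<noteq> 0" using that by (intro a) (auto simp: T_def)
      then show ?thesis by (auto simp: W fps_unit_def fps_shift_at_nth_0)
    qed
  next
    fix b R assume b: "b \<in> B" and R: "(1::nat) \<le> R"
    define x where "x = tser b n $ R"
    \<comment> \<open>Erasing the coefficient \<open>x\<close> at order \<open>R\<close> amounts to
      the displacement c - x t^R.\<close>
    have erased: "ev cst (inser_erased R b c) C =
        (\<Sum>j\<le>D. \<phi> b (coeff q j) * (cst c - fps_const x * fps_X ^ R) ^ j)" for c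
    proof -
      define qb where "qb = ev (\<lambda>c. [:\<phi> b (Const c):]) (\<lambda>l. if l < n then [:\<phi> b (Delta k P l):]
        else if l = n then [:\<phi> b (Delta k P n), 1:] else [:\<phi> b (Const (\<beta> l)):]) C"
      have "coeff qb j = \<phi> b (coeff q j)" for j
        unfolding qb_def q_def
        by (rule coeff_ev_hom[OF hom is_hom_Const])
          (auto simp: coeff_pCons hom_one[OF hom] hom_zero[OF hom] split: nat.splits)
      moreover have "degree qb \<le> D"
        unfolding qb_def by (rule order_trans[OF degree_ev_le]) (use C in auto)
      moreover have "poly qb (cst c - fps_const x * fps_X ^ R) = ev cst (inser_erased R b c) C"
        unfolding qb_def hom_ev[OF is_hom_poly]
        by (intro arg_cong2[where f="\<lambda>h f. ev h f C"] ext)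
          (auto simp: inser_erased_def inser_def tser x_def)
      ultimately show ?thesis using poly_eq_sum_upto[of qb D] by simp
    qed
    \<comment> \<open>Summing over \<open>\<Gamma>\<close> leaves the coefficient r - 1 of
      \<open>q\<close>, which is zero, and the linear perturbation of the power of degree
      \<open>r\<close>.\<close>
    have power_term: "(\<Sum>c\<in>\<Gamma>. Const (w c) * (\<phi> b (coeff q j) * (cst c - fps_const x * fps_X ^ R) ^ j) $ R) =
        (if j = r then - (Const (\<kappa> b) * x) else 0)" if j: "j \<le> D" for j
    proof -
      have "(\<Sum>c\<in>\<Gamma>. Const (w c) * (\<phi> b (coeff q j) * (cst c - fps_const x * fps_X ^ R) ^ j) $ R) =
          (\<Sum>c\<in>\<Gamma>. Const (w c * c ^ j) * \<phi> b (coeff q j) $ R -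
            Const (w c * c ^ (j - 1)) * (of_nat j * (x * \<phi> b (coeff q j) $ 0)))"
        unfolding nth_mult_perturbed_power[OF R]
        by (simp add: Const_mult Const_of_nat algebra_simps)
      also have "\<dots> = Const (\<Sum>c\<in>\<Gamma>. w c * c ^ j) * \<phi> b (coeff q j) $ R -
          Const (\<Sum>c\<in>\<Gamma>. w c * c ^ (j - 1)) * (of_nat j * (x * \<phi> b (coeff q j) $ 0))"
        by (simp only: hom_sum[OF is_hom_Const] sum_subtractf sum_distrib_right)
      also have "(\<Sum>c\<in>\<Gamma>. w c * c ^ j) = (if j = r - 1 then 1 else 0)" using w j by blast
      also have "(\<Sum>c\<in>\<Gamma>. w c * c ^ (j - 1)) = (if j - 1 = r - 1 then 1 else 0)" using w j by simp
      also have "Const (if j = r - 1 then 1 else 0) * \<phi> b (coeff q j) $ R = 0"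
        using below_r[of "r - 1"] \<open>r \<ge> 1\<close> by (simp add: hom_zero[OF hom])
      also have "0 - Const (if j - 1 = r - 1 then 1 else 0) * (of_nat j * (x * \<phi> b (coeff q j) $ 0)) =
          (if j = r then - (Const (\<kappa> b) * x) else 0)"
      proof (cases "j = r")
        case True
        have "\<phi> b (coeff q r) $ 0 = Const (ev (\<lambda>c. c) a (spec_y k b (coeff q r)))"
          by (simp add: \<phi>_def fps_shift_at_nth_0)
        then show ?thesis using True by (simp add: \<kappa>_def Const_mult Const_of_nat mult_ac)
      next
        case False
        \<comment> \<open>For j = 0 and r = 1 truncation gives j - 1 = r - 1, but the factor
          \<open>of_nat j\<close> vanishes.\<close>
        then show ?thesis using \<open>r \<ge> 1\<close> by (cases j) auto
      qed
      finally show ?thesis .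
    qed
    have "(\<Sum>c\<in>\<Gamma>. Const (w c) * ev cst (inser_erased R b c) C $ R) = (\<Sum>j\<le>D. \<Sum>c\<in>\<Gamma>.
        Const (w c) * (\<phi> b (coeff q j) * (cst c - fps_const x * fps_X ^ R) ^ j) $ R)"
      unfolding erased fps_sum_nth sum_distrib_left by (rule sum.swap)
    also have "\<dots> = (\<Sum>j\<le>D. if j = r then - (Const (\<kappa> b) * x) else 0)"
      using power_term by (intro sum.cong) auto
    also have "\<dots> = - (Const (\<kappa> b) * x)" using \<open>r \<le> D\<close> by simp
    finally have sum: "(\<Sum>c\<in>\<Gamma>. Const (w c) * ev cst (inser_erased R b c) C $ R) = - (Const (\<kappa> b) * x)" .
    have "(\<Sum>c\<in>\<Gamma>. Const (- w c / \<kappa> b) * ev cst (inser_erased R b c) C $ R) =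
        Const (- 1 / \<kappa> b) * (\<Sum>c\<in>\<Gamma>. Const (w c) * ev cst (inser_erased R b c) C $ R)"
      unfolding sum_distrib_left mult.assoc[symmetric] Const_mult[symmetric] by simp
    also have "\<dots> = Const (- 1 / \<kappa> b * - \<kappa> b) * x"
      unfolding sum Const_mult by (simp add: Const_uminus mult.assoc)
    also have "- 1 / \<kappa> b * - \<kappa> b = 1" using \<kappa>[OF b] by simp
    finally show "tser b n $ R =
        (\<Sum>c\<in>\<Gamma>. Const (- w c / \<kappa> b) * ev cst (inser_erased R b c) (val (out G)) $ R)"
      by (simp add: G(3) x_def)
  qed (use P G B \<Gamma> \<mu> in auto)
  have "card (exponents k n) \<le> card (exps k n)"
    by (rule card_mono[OF finite_exps]) (auto simp: exps_def)
  then show ?thesis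
    using computable[OF assms(2)] B(3) \<Gamma>(2) by (intro exI[of _ "card B"] exI[of _ "card \<Gamma>"]) auto
qed

text \<open>With U = n^k, M = U^2 and T = s D d^3, \<open>N\<close> is at most M and each summand is
  at most T M times a polynomial in U of degree at most 2. Since U is at least 2, the sum is at most
  T U^10.\<close>

lemma size_bound:
  fixes k d n \<nu> D s N u w g :: nat
  assumes "k > 0" "d > 0" "D > 0" "s > 0" and \<nu>: "2 \<le> \<nu>" "\<nu> \<le> n"
    and N: "N \<le> (\<nu> + 1) ^ k" and u: "u \<le> N" and w: "w \<le> D + 1" and g: "g \<le> s"
  shows "k + (k + 2 + (\<nu> + 1) * (N * (k + 2)) + u * w * g +
      d * (2 * (u * w * (g * (d + 2))) + u + N * (k + 2)) + 1) \<le> s * D * d ^ 3 * n ^ (10 * k)"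
proof -
  define U where "U = n ^ k"
  define M where "M = U ^ 2"
  define T where "T = s * D * d ^ 3"
  have "n \<ge> 2" using \<nu> by simp
  have "n + 1 \<le> n ^ 2"
    using mult_le_mono1[OF \<open>n \<ge> 2\<close>, of n] \<open>n \<ge> 2\<close> unfolding power2_eq_square by linarith
  then have "(\<nu> + 1) ^ k \<le> (n ^ 2) ^ k" using \<nu> by (intro power_mono) auto
  then have NM: "N \<le> M" using N by (simp add: M_def U_def mult.commute flip: power_mult)
  have "n ^ 1 \<le> U" unfolding U_def using \<open>n \<ge> 2\<close> \<open>k > 0\<close> by (intro power_increasing) auto
  then have nU: "n \<le> U" by simp
  have "k < 2 ^ k" by (rule less_exp)
  also have "(2::nat) ^ k \<le> U" unfolding U_def using \<open>n \<ge> 2\<close> by (rule power_mono) simp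
  finally have kU: "k \<le> U" by simp
  have "U \<ge> 2" using nU \<open>n \<ge> 2\<close> by simp
  then have "M \<ge> 1" by (simp add: M_def)
  have sDd: "s * D * d ^ i \<le> T" if "i \<le> 3" for i
    unfolding T_def using that \<open>d > 0\<close> by (intro mult_left_mono power_increasing) auto
  have T: "1 \<le> T" "d \<le> T"
  proof -
    show "1 \<le> T" using assms by (simp add: T_def Suc_le_eq)
    have "d ^ 1 \<le> d ^ 3" using \<open>d > 0\<close> by (intro power_increasing) auto
    moreover have "1 * d ^ 3 \<le> T" unfolding T_def using assms by (intro mult_right_mono) auto
    ultimately show "d \<le> T" by simp
  qed
  have uw: "u * w \<le> M * (2 * D)" using u w NM \<open>D > 0\<close> by (intro mult_mono) auto
  have t1: "u * w * g \<le> 2 * (T * M)"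
  proof -
    have "u * w * g \<le> M * (2 * D) * s" using uw g by (rule mult_le_mono)
    also have "\<dots> = 2 * ((s * D * d ^ 0) * M)" by simp
    also have "\<dots> \<le> 2 * (T * M)" using sDd[of 0] by (intro mult_left_mono mult_right_mono) auto
    finally show ?thesis .
  qed
  have t2: "d * (2 * (u * w * (g * (d + 2)))) \<le> 12 * (T * M)"
  proof -
    have "d * (2 * (u * w * (g * (d + 2)))) \<le> d * (2 * (M * (2 * D) * (s * (3 * d))))"
      using g \<open>d > 0\<close> by (intro mult_le_mono uw le_refl) auto
    also have "\<dots> = 12 * ((s * D * d ^ 2) * M)" by (simp add: power2_eq_square)
    also have "\<dots> \<le> 12 * (T * M)" using sDd[of 2] by (intro mult_left_mono mult_right_mono) auto
    finally show ?thesis .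
  qed
  have t3: "d * u \<le> T * M" using T(2) u NM by (intro mult_mono) auto
  have t4: "d * (N * (k + 2)) \<le> T * M * (U + 2)"
    unfolding mult.assoc using T(2) NM kU by (intro mult_mono) auto
  have t5: "(\<nu> + 1) * (N * (k + 2)) \<le> T * M * ((U + 1) * (U + 2))"
  proof -
    have "(\<nu> + 1) * (N * (k + 2)) \<le> (U + 1) * (M * (U + 2))"
      using \<nu> nU NM kU by (intro mult_mono) auto
    also have "\<dots> = 1 * (M * ((U + 1) * (U + 2)))" by (simp add: algebra_simps)
    also have "\<dots> \<le> T * (M * ((U + 1) * (U + 2)))" using T(1) by (rule mult_right_mono) simp
    finally show ?thesis by (simp only: mult.assoc)
  qed
  have t6: "2 * k + 3 \<le> T * M * (2 * U + 3)"
  proof -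
    have "2 * k + 3 \<le> 1 * 1 * (2 * U + 3)" using kU by simp
    also have "\<dots> \<le> T * M * (2 * U + 3)" using T(1) \<open>M \<ge> 1\<close> by (intro mult_mono) auto
    finally show ?thesis .
  qed
  have "k + (k + 2 + (\<nu> + 1) * (N * (k + 2)) + u * w * g +
      d * (2 * (u * w * (g * (d + 2))) + u + N * (k + 2)) + 1) =
      (2 * k + 3) + (\<nu> + 1) * (N * (k + 2)) + u * w * g + d * (2 * (u * w * (g * (d + 2)))) + d * u +
      d * (N * (k + 2))"
    by (simp only: distrib_left)
  also have "\<dots> \<le> T * M * (2 * U + 3) + T * M * ((U + 1) * (U + 2)) + 2 * (T * M) + 12 * (T * M) +
      T * M + T * M * (U + 2)"
    by (intro add_mono t1 t2 t3 t4 t5 t6)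
  also have "\<dots> = T * M * (U ^ 2 + 6 * U + 22)"
    by (simp add: algebra_simps power2_eq_square)
  also have "\<dots> \<le> T * M * U ^ 8"
  proof (rule mult_left_mono)
    have "6 * U \<le> 3 * U ^ 2" "22 \<le> 6 * U ^ 2"
      using mult_le_mono[OF \<open>U \<ge> 2\<close> \<open>U \<ge> 2\<close>] mult_le_mono1[OF \<open>U \<ge> 2\<close>, of U]
      by (simp_all add: power2_eq_square)
    \<comment> \<open>The constant is 2^6, which U^6 absorbs.\<close>
    then have "U ^ 2 + 6 * U + 22 \<le> 64 * U ^ 2" by simp
    also have "\<dots> \<le> U ^ 6 * U ^ 2"
      using power_mono[OF \<open>U \<ge> 2\<close>, of 6] by (intro mult_right_mono) auto
    finally show "U ^ 2 + 6 * U + 22 \<le> U ^ 8" by (simp flip: power_add)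
  qed simp
  also have "\<dots> = T * U ^ 10" by (simp add: M_def mult.assoc flip: power_add)
  also have "U ^ 10 = n ^ (10 * k)" by (simp add: U_def mult.commute flip: power_mult)
  finally show ?thesis by (simp add: T_def)
qed

section \<open>The indices 0 and 1, and the conclusion\<close>

lemma computable_in_size_mono:
  "computable_in_size k s p \<Longrightarrow> s \<le> s' \<Longrightarrow> computable_in_size k s' p"
  unfolding computable_in_size_def by (meson order_trans)

text \<open>\<open>Delta k P 0\<close> is \<open>P\<close>, whose values are not confined to the
  finitely many roots of a nonzero univariate polynomial.\<close>

lemma no_relation_0:
  fixes P C :: "'a::field_char_0 mpoly"
  assumes "total_degree P > 0" and "ev Const (\<lambda>l. Const (\<beta> l)) C \<noteq> 0"
  shows "ev Const (\<lambda>l. if l < Suc 0 then Delta k P l else Const (\<beta> l)) C \<noteq> 0"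
proof
  assume zero: "ev Const (\<lambda>l. if l < Suc 0 then Delta k P l else Const (\<beta> l)) C = 0"
  define q where "q = ev (\<lambda>c. [:c:]) (\<lambda>l. if l = 0 then [:0, 1:] else [:\<beta> l:]) C"
  have poly_q: "poly q y = ev (\<lambda>c. c) (\<lambda>l. if l = 0 then y else \<beta> l) C" for y
    unfolding q_def hom_ev[OF is_hom_poly]
    by (intro arg_cong2[where f="\<lambda>h f. ev h f C"] ext) auto
  have "Const (ev (\<lambda>c. c) \<beta> C) \<noteq> 0"
    using assms(2) by (simp add: hom_ev[OF is_hom_Const])
  moreover have "(\<lambda>l. if l = 0 then \<beta> 0 else \<beta> l) = \<beta>" by auto
  ultimately have "poly q (\<beta> 0) \<noteq> 0" by (simp add: poly_q)
  then have "finite {y. poly q y = 0}" by (intro poly_roots_finite) auto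
  then obtain x where x: "poly q (ev (\<lambda>c. c) x P) \<noteq> 0"
    using ev_values_not_finite[OF assms(1)] by blast
  have "ev (\<lambda>c. c) x (ev Const (\<lambda>l. if l < Suc 0 then Delta k P l else Const (\<beta> l)) C) =
      poly q (ev (\<lambda>c. c) x P)"
    unfolding ev_ev[OF is_hom_id] poly_q
    by (intro arg_cong[where f="\<lambda>f. ev (\<lambda>c. c) f C"] ext) (auto simp: Delta_0)
  then show False using x unfolding zero by simp
qed

lemma no_relation_1:
  fixes P C :: "'a::field_char_0 mpoly"
  assumes P: "P \<in> mpolys k" "total_degree P > 0"
    and nonzero: "ev Const (\<lambda>l. if l < 1 then Delta k P l else Const (\<beta> l)) C \<noteq> 0"
  shows "ev Const (\<lambda>l. if l < Suc 1 then Delta k P l else Const (\<beta> l)) C \<noteq> 0"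
proof
  let ?ev = "ev (\<lambda>c::'a. c)"
  assume zero: "ev Const (\<lambda>l. if l < Suc 1 then Delta k P l else Const (\<beta> l)) C = 0"
  let ?F = "ev Const (\<lambda>l. if l < 1 then Delta k P l else Const (\<beta> l)) C"
  obtain j where j: "j < k" "pderiv_mpoly j P \<noteq> 0" using exists_pderiv_nonzero[OF P] by blast
  obtain x where x: "?ev x ?F \<noteq> 0" "?ev x (pderiv_mpoly j P) \<noteq> 0"
    using exists_common_nonzero_point[of "{?F, pderiv_mpoly j P}"] nonzero j(2) by auto
  \<comment> \<open>z is kept, and y is supported on the coordinate \<open>j\<close>.\<close>
  define x' where "x' i = (if i < k then x i else if i = k + j then \<beta> 1 / ?ev x (pderiv_mpoly j P)
    else 0)" for i
  have same: "?ev x' p = ?ev x p" if "p \<in> mpolys k" for p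
    by (rule ev_cong[OF that]) (simp add: x'_def)
  have "?ev x' (Delta k P 1) = (\<Sum>i<k. x' (k + i) * ?ev x (pderiv_mpoly i P))"
    unfolding ev_Delta_1[OF P(1)] using same pderiv_in_mpolys[OF P(1)] by simp
  also have "\<dots> = (\<Sum>i<k. if i = j then \<beta> 1 else 0)"
    using x(2) by (intro sum.cong) (auto simp: x'_def)
  also have "\<dots> = \<beta> 1" using j(1) by simp
  finally have D1: "?ev x' (Delta k P 1) = \<beta> 1" .
  have D0: "?ev x' (Delta k P 0) = ?ev x (Delta k P 0)"
    using same[OF P(1)] by (simp add: Delta_0)
  have "?ev x' (ev Const (\<lambda>l. if l < Suc 1 then Delta k P l else Const (\<beta> l)) C) = ?ev x ?F"
    unfolding ev_ev[OF is_hom_id]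
    by (intro arg_cong[where f="\<lambda>f. ?ev f C"] ext)
      (use D0 D1 in \<open>auto simp: less_Suc_eq\<close>)
  then show False using x(1) unfolding zero by simp
qed

theorem theorem1p12:
  fixes P C :: "'a::field_char_0 mpoly" and k d n D s :: nat
  assumes "k > 0" and "d > 0"
    and "P \<in> mpolys k" and "total_degree P = d"
    and "n > 0" and "D > 0" and "s > 0"
    and "\<not> computable_in_size k (s * D * d ^ 3 * n ^ (10 * k)) P"
    and "C \<in> circuit_class (n + 1) D s"
  shows "C \<noteq> 0 \<longleftrightarrow> compose_Gen C (Gen k n P) \<noteq> 0"
proof
  assume "compose_Gen C (Gen k n P) \<noteq> 0"
  then show "C \<noteq> 0" by (auto simp: compose_Gen_def mpoly_subst_ev)
next
  assume "C \<noteq> 0"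
  show "compose_Gen C (Gen k n P) \<noteq> 0"
  proof
    assume zero: "compose_Gen C (Gen k n P) = 0"
    have C: "C \<in> mpolys (n + 1)" "total_degree C \<le> D" "computable_in_size (n + 1) s C"
      using assms(9) by (auto simp: circuit_class_def)
    obtain G val where G: "is_circuit (n + 1) G" "card (nodes G) \<le> s"
      "circuit_valuation G val" "val (out G) = C"
      using C(3) unfolding computable_in_size_def computes_def circuit_size_def by blast
    obtain \<beta> where \<beta>: "ev (\<lambda>c. c) \<beta> C \<noteq> 0" using exists_nonzero_point[OF C(1) \<open>C \<noteq> 0\<close>] by blast
    \<comment> \<open>\<open>F 0\<close> is a nonzero constant and \<open>F (n + 1)\<close> is the
      composition. If the latter vanishes, some step from \<open>F \<nu>\<close> to
      \<open>F (Suc \<nu>)\<close> passes from nonzero to zero.\<close>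
    define F where "F i = ev Const (\<lambda>l. if l < i then Delta k P l else Const (\<beta> l)) C" for i :: nat
    have "F 0 = Const (ev (\<lambda>c. c) \<beta> C)"
      by (simp add: F_def hom_ev[OF is_hom_Const])
    then have "F 0 \<noteq> 0" using \<beta> by simp
    moreover have "F (n + 1) = compose_Gen C (Gen k n P)"
      unfolding F_def compose_Gen_def mpoly_subst_ev
      by (rule ev_cong[OF C(1)]) (simp add: Gen_def nth_append del: upt_Suc)
    ultimately obtain \<nu> where \<nu>: "\<nu> < n + 1" "F \<nu> \<noteq> 0" "F (Suc \<nu>) = 0"
      using zero ex_least_nat_less[of "\<lambda>i. F i = 0" "n + 1"] by auto
    have "\<nu> \<noteq> 0"
    proof
      assume "\<nu> = 0"
      then show False using no_relation_0[of P \<beta> C k] \<nu> assms(2,4) unfolding F_def by simp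
    qed
    moreover have "\<nu> \<noteq> 1"
      using no_relation_1[OF assms(3), of \<beta> C] \<nu> assms(2,4) by (auto simp: F_def)
    ultimately have "2 \<le> \<nu>" "\<nu> \<le> n" using \<nu>(1) by auto
    obtain u w where uw: "u \<le> card (exps k \<nu>)" "w \<le> D + 1"
      "computable_in_size k (k + (k + 2 + (\<nu> + 1) * (card (exps k \<nu>) * (k + 2)) + u * w * card (nodes G) +
        d * (2 * (u * w * (card (nodes G) * (d + 2))) + u + card (exps k \<nu>) * (k + 2)) + 1)) P"
      using vanishing_imp_computable[OF assms(3) _ C(2) G(1,3,4) \<nu>(2,3)[unfolded F_def], of d] assms(4)
      by auto
    have "computable_in_size k (s * D * d ^ 3 * n ^ (10 * k)) P"
      using assms \<open>2 \<le> \<nu>\<close> \<open>\<nu> \<le> n\<close> uw G(2)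
      by (intro computable_in_size_mono[OF uw(3) size_bound] card_exps_le) auto
    then show False using assms(8) by contradiction
  qed
qed

end
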